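(* Let $1 \leq p \leq \infty$. In the setting described in the context, assume $\xi\equiv 0$ (so $Z=Y=W\circ T$), $b \in C_b(\mathbb{R}^d;\mathbb{R}^d)$, and that there exists $\delta>0$ such that \[ \int_0^\delta \mathbb{E}\, T_s^{-\frac12-\frac{d}{2p}}\,ds < \infty \] (with $d/p=0$ when $p=\infty$). Then for every $t>0$ and every $f \in L_p(\mathbb{R}^d)$ one has $P^X_t f \in C_b(\mathbb{R}^d)$, where $P^X_t f(x) = \mathbb{E} f(X^x_t)$ is computed with a Borel representative of $f$.
   Context: $W$ is a standard $\mathbb{R}^d$-valued Wiener process (identity covariance). A subordinator is an increasing Lévy process $T:\mathbb{R}_+\to\mathbb{R}_+$ with $T_0=0$ and $T_t>0$ for $t>0$; $T$ is independent of $W$, and $Y_t := W_{T_t}$. $\xi$ is an $\mathbb{R}^d$-valued Lévy process independent of $Y$, and $Z := Y+\xi$. $b:\mathbb{R}^d\to\mathbb{R}^d$ is continuous. Standing assumption: for each $x\in\mathbb{R}^d$ the SDE $dX_t=b(X_t)\,dt+dZ_t$, $X_0=x$, has a Markovian weak solution $X^x$, and the transition semigroup $P^X_t f(x) := \mathbb{E} f(X^x_t)$ is Feller for all $t\geq 0$, i.e. $P^X_t$ maps $C_b(\mathbb{R}^d)$ (bounded continuous functions) into $C_b(\mathbb{R}^d)$. *)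

theory Defs
  imports "HOL-Probability.Probability" "HOL-Probability.Conditional_Expectation"
begin

definition gauss_vec :: "real \<Rightarrow> (real ^ 'd::finite) measure" where
  "gauss_vec c = density lborel
     (\<lambda>x. ennreal ((2 * pi * c) powr (- real CARD('d) / 2) * exp (- (norm x)\<^sup>2 / (2 * c))))"

definition indep_increments :: "'a measure \<Rightarrow> (real \<Rightarrow> 'a \<Rightarrow> 'b::{real_normed_vector,second_countable_topology}) \<Rightarrow> bool" where
  "indep_increments M Y \<longleftrightarrow>
     (\<forall>(n::nat) (ts::nat \<Rightarrow> real). 0 \<le> ts 0 \<and> (\<forall>i<n. ts i < ts (Suc i)) \<longrightarrow>
        prob_space.indep_vars M (\<lambda>_. borel) (\<lambda>i \<omega>. Y (ts (Suc i)) \<omega> - Y (ts i) \<omega>) {..<n})"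

definition wiener_process :: "'a measure \<Rightarrow> (real \<Rightarrow> 'a \<Rightarrow> real ^ 'd::finite) \<Rightarrow> bool" where
  "wiener_process M W \<longleftrightarrow> prob_space M \<and>
     (\<forall>t. W t \<in> borel_measurable M) \<and>
     (\<forall>\<omega>\<in>space M. W 0 \<omega> = 0 \<and> continuous_on {0..} (\<lambda>t. W t \<omega>)) \<and>
     (\<forall>s t. 0 \<le> s \<and> s < t \<longrightarrow> distr M borel (\<lambda>\<omega>. W t \<omega> - W s \<omega>) = gauss_vec (t - s)) \<and>
     indep_increments M W"

definition subordinator :: "'a measure \<Rightarrow> (real \<Rightarrow> 'a \<Rightarrow> real) \<Rightarrow> bool" where
  "subordinator M T \<longleftrightarrow> prob_space M \<and>
     (\<forall>t. T t \<in> borel_measurable M) \<and>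
     (\<forall>\<omega>\<in>space M. T 0 \<omega> = 0 \<and> mono_on {0..} (\<lambda>t. T t \<omega>) \<and>
        (\<forall>t>0. T t \<omega> > 0) \<and>
        (\<forall>t\<ge>0. continuous (at_right t) (\<lambda>s. T s \<omega>)) \<and>
        (\<forall>t>0. \<exists>l. ((\<lambda>s. T s \<omega>) \<longlongrightarrow> l) (at_left t))) \<and>
     (\<forall>s t. 0 \<le> s \<and> 0 \<le> t \<longrightarrow> distr M borel (\<lambda>\<omega>. T (s + t) \<omega> - T s \<omega>) = distr M borel (T t)) \<and>
     indep_increments M T"

definition same_fdd :: "'a measure \<Rightarrow> (real \<Rightarrow> 'a \<Rightarrow> real) \<Rightarrow> 'b measure \<Rightarrow> (real \<Rightarrow> 'b \<Rightarrow> real) \<Rightarrow> bool" where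
  "same_fdd M T N S \<longleftrightarrow>
     (\<forall>(n::nat) (ts::nat \<Rightarrow> real). (\<forall>i<n. 0 \<le> ts i) \<longrightarrow>
        distr M (PiM {..<n} (\<lambda>_. borel)) (\<lambda>\<omega>. \<lambda>i\<in>{..<n}. T (ts i) \<omega>)
        = distr N (PiM {..<n} (\<lambda>_. borel)) (\<lambda>\<omega>. \<lambda>i\<in>{..<n}. S (ts i) \<omega>))"

definition nat_filtration :: "'a measure \<Rightarrow> (real \<Rightarrow> 'a \<Rightarrow> 'b::topological_space) \<Rightarrow> real \<Rightarrow> 'a measure" where
  "nat_filtration M X s = sigma (space M)
     {X r -` A \<inter> space M | r A. 0 \<le> r \<and> r \<le> s \<and> A \<in> sets borel}"

definition proc_sigma :: "'a measure \<Rightarrow> (real \<Rightarrow> 'a \<Rightarrow> 'b::topological_space) \<Rightarrow> 'a set set" where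
  "proc_sigma M Y = sigma_sets (space M) {Y t -` A \<inter> space M | t A. 0 \<le> t \<and> A \<in> sets borel}"

definition trans_sg :: "('x \<Rightarrow> 'a measure) \<Rightarrow> ('x \<Rightarrow> real \<Rightarrow> 'a \<Rightarrow> 'x) \<Rightarrow> real \<Rightarrow> ('x \<Rightarrow> real) \<Rightarrow> 'x \<Rightarrow> real" where
  "trans_sg M X t f x = (\<integral>\<omega>. f (X x t \<omega>) \<partial>M x)"

definition Lp_fun :: "ennreal \<Rightarrow> (real ^ 'd::finite \<Rightarrow> real) \<Rightarrow> bool" where
  "Lp_fun p f \<longleftrightarrow> f \<in> borel_measurable lborel \<and>
     (if p = \<top> then (\<exists>C. AE x in lborel. \<bar>f x\<bar> \<le> C)
      else (\<integral>\<^sup>+ x. ennreal (\<bar>f x\<bar> powr enn2real p) \<partial>lborel) < \<top>)"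

definition d_over_p :: "nat \<Rightarrow> ennreal \<Rightarrow> real" where
  "d_over_p d p = (if p = \<top> then 0 else real d / enn2real p)"

end

theory Submission
  imports Defs
begin

text \<open>
  Let \<open>Q\<^sub>t f(x) = E f(x + W\<^sub>T\<^sub>(\<^sub>t\<^sub>))\<close> be the semigroup of the noise and \<open>P\<^sub>t\<close> that of the solution.
  Over a time step \<open>h\<close> the drift moves the solution by at most \<open>h * sup |b|\<close>, hence
  \<open>|P\<^sub>h g - Q\<^sub>h g| \<le> h * sup |b| * Lip g\<close>. From
  \<open>P\<^sub>h\<^sub>+\<^sub>s f - Q\<^sub>h\<^sub>+\<^sub>s f = P\<^sub>h (P\<^sub>s f - Q\<^sub>s f) + (P\<^sub>h - Q\<^sub>h) Q\<^sub>s f\<close> and the gradient bound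
  \<open>Lip (Q\<^sub>s f) \<le> c * \<phi>(s) * |f|\<^sub>p\<close>, where \<open>\<phi>(s) = 1 + E T(s) powr (- 1/2 - d/(2p))\<close> is decreasing, iteration with
  \<open>h = t/n\<close> gives \<open>|P\<^sub>t f - Q\<^sub>t f| \<le> |P\<^sub>h f - Q\<^sub>h f| + c * sup |b| * |f|\<^sub>p * F(t)\<close>, where \<open>F\<close> is the
  integral of \<open>\<phi>\<close> over \<open>(0, t]\<close>.

  For Lipschitz \<open>f\<close> the first term vanishes as \<open>n\<close> grows. The case \<open>p = \<infinity>\<close> thus
  bounds the total variation distance of the two transition kernels by a multiple of \<open>F(t)\<close>. Consequently \<open>P\<^sub>t f\<close> is,
  for bounded Borel \<open>f\<close>, the uniform limit of the functions \<open>P\<^sub>t\<^sub>-\<^sub>s (Q\<^sub>s f)\<close> as \<open>s\<close> tends to \<open>0\<close>, which are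
  continuous by the Feller property. The total variation bound also makes the first term vanish for
  all bounded Borel \<open>f\<close>, so that \<open>|P\<^sub>t f| \<le> D(t) * |f|\<^sub>p\<close>, and truncation of \<open>f \<in> L\<^sub>p\<close> finishes the proof.
\<close>

section \<open>Gaussian kernels\<close>

text \<open>By the mean value theorem the difference is
  \<open>(b - a) * z * exp (- z\<^sup>2 / 2)\<close> for some \<open>z\<close> between
  \<open>a\<close> and \<open>b\<close>. The factor \<open>z\<close> is at most
  \<open>exp (z\<^sup>2 / 4)\<close> and thus costs half of the exponent: the bound is again
  Gaussian, with twice the variance.\<close>

lemma exp_neg_square_diff_le:
  fixes a b :: real
  assumes "0 \<le> a" "a \<le> b"
  shows "exp (- a\<^sup>2 / 2) - exp (- b\<^sup>2 / 2) \<le> (b - a) * exp (- a\<^sup>2 / 4)"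
proof (cases "a = b")
  case False
  with assms have "a < b" by simp
  have der: "((\<lambda>x. exp (- x\<^sup>2 / 2)) has_real_derivative (- x * exp (- x\<^sup>2 / 2))) (at x)" for x :: real
    by (auto intro!: derivative_eq_intros)
  obtain z where z: "a < z" "z < b"
    "exp (- b\<^sup>2 / 2) - exp (- a\<^sup>2 / 2) = (b - a) * (- z * exp (- z\<^sup>2 / 2))"
    using MVT2[OF \<open>a < b\<close>, of "\<lambda>x. exp (- x\<^sup>2 / 2)" "\<lambda>x. - x * exp (- x\<^sup>2 / 2)"] der by blast
  have "z \<le> 1 + z\<^sup>2 / 4"
    using zero_le_power2[of "z / 2 - 1"] by (simp add: power2_eq_square field_simps)
  also have "\<dots> \<le> exp (z\<^sup>2 / 4)" by (rule exp_ge_add_one_self)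
  finally have "z * exp (- z\<^sup>2 / 2) \<le> exp (z\<^sup>2 / 4) * exp (- z\<^sup>2 / 2)"
    by (intro mult_right_mono) auto
  also have "\<dots> = exp (- z\<^sup>2 / 4)" by (simp flip: exp_add)
  also have "\<dots> \<le> exp (- a\<^sup>2 / 4)"
    using assms z by (simp add: power_mono)
  finally have "(b - a) * (z * exp (- z\<^sup>2 / 2)) \<le> (b - a) * exp (- a\<^sup>2 / 4)"
    using \<open>a < b\<close> by (intro mult_left_mono) auto
  with z(3) show ?thesis by simp
qed simp

definition gauss_dens :: "real \<Rightarrow> real ^ 'd::finite \<Rightarrow> real" where
  "gauss_dens c x = (2 * pi * c) powr (- real CARD('d) / 2) * exp (- (norm x)\<^sup>2 / (2 * c))"

lemma gauss_dens_nonneg [simp]: "0 \<le> gauss_dens c x"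
  by (simp add: gauss_dens_def)

lemma gauss_dens_measurable [measurable]: "gauss_dens c \<in> borel_measurable borel"
  unfolding gauss_dens_def by measurable

lemma gauss_vec_eq_density: "gauss_vec c = density lborel (\<lambda>x. ennreal (gauss_dens c x))"
  by (simp add: gauss_vec_def gauss_dens_def)

lemma sets_gauss_vec [simp, measurable_cong]: "sets (gauss_vec c) = sets borel"
  by (simp add: gauss_vec_eq_density)

lemma space_gauss_vec [simp]: "space (gauss_vec c) = UNIV"
  by (simp add: gauss_vec_eq_density)

text \<open>The density is radial, so scaling by \<open>sqrt r\<close> reduces the claim to
  \<open>exp_neg_square_diff_le\<close> for the norms. The power of 2 is the ratio of the
  normalising factors for the variances \<open>r\<close> and \<open>2 * r\<close>. Both points
  appear on the right to make the bound symmetric, so that \<open>u\<close> may be taken as the one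
  of smaller norm.\<close>

lemma gauss_dens_diff_le:
  fixes u v :: "real ^ 'd::finite"
  assumes "0 < r"
  shows "\<bar>gauss_dens r u - gauss_dens r v\<bar>
    \<le> 2 powr (real CARD('d) / 2) * r powr (- 1/2) * norm (u - v) * (gauss_dens (2 * r) u + gauss_dens (2 * r) v)"
proof -
  define C where "C = (2 * pi * r) powr (- real CARD('d) / 2)"
  have C: "C = 2 powr (real CARD('d) / 2) * (2 * pi * (2 * r)) powr (- real CARD('d) / 2)"
  proof -
    have "(2 * pi * (2 * r)) powr (- real CARD('d) / 2) = (2 * (2 * pi * r)) powr (- real CARD('d) / 2)"
      by (simp add: mult_ac)
    also have "\<dots> = 2 powr (- real CARD('d) / 2) * C"
      unfolding C_def using assms by (subst powr_mult) auto
    finally show ?thesis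
      by (simp add: powr_minus)
  qed
  have main: "\<bar>gauss_dens r u - gauss_dens r v\<bar>
    \<le> 2 powr (real CARD('d) / 2) * r powr (- 1/2) * norm (u - v) * (gauss_dens (2 * r) u + gauss_dens (2 * r) v)"
    if "norm u \<le> norm v" for u v :: "real ^ 'd"
  proof -
    define a where "a = norm u / sqrt r"
    define b where "b = norm v / sqrt r"
    have ab: "0 \<le> a" "a \<le> b" using that assms by (auto simp: a_def b_def divide_right_mono)
    have eqs: "exp (- a\<^sup>2 / 2) = exp (- (norm u)\<^sup>2 / (2 * r))"
      "exp (- b\<^sup>2 / 2) = exp (- (norm v)\<^sup>2 / (2 * r))"
      "exp (- a\<^sup>2 / 4) = exp (- (norm u)\<^sup>2 / (2 * (2 * r)))"
      using assms by (simp_all add: a_def b_def power_divide mult.commute)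
    have "b - a = (norm v - norm u) * r powr (- 1/2)"
      using assms powr_minus_divide[of r "1/2"] by (simp add: a_def b_def powr_half_sqrt diff_divide_distrib)
    also have "\<dots> \<le> norm (u - v) * r powr (- 1/2)"
      by (intro mult_right_mono) (use norm_triangle_ineq2[of v u] in \<open>auto simp: norm_minus_commute\<close>)
    finally have ba: "b - a \<le> norm (u - v) * r powr (- 1/2)" .
    have "\<bar>exp (- a\<^sup>2 / 2) - exp (- b\<^sup>2 / 2)\<bar> = exp (- a\<^sup>2 / 2) - exp (- b\<^sup>2 / 2)"
      using ab by (simp add: power_mono)
    also have "\<dots> \<le> (b - a) * exp (- a\<^sup>2 / 4)"
      by (rule exp_neg_square_diff_le[OF ab])
    also have "\<dots> \<le> norm (u - v) * r powr (- 1/2) * exp (- a\<^sup>2 / 4)"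
      by (intro mult_right_mono ba) auto
    finally have 1: "\<bar>exp (- a\<^sup>2 / 2) - exp (- b\<^sup>2 / 2)\<bar> \<le> norm (u - v) * r powr (- 1/2) * exp (- a\<^sup>2 / 4)" .
    have "\<bar>gauss_dens r u - gauss_dens r v\<bar> = C * \<bar>exp (- a\<^sup>2 / 2) - exp (- b\<^sup>2 / 2)\<bar>"
      unfolding gauss_dens_def C_def[symmetric] eqs
      by (simp add: right_diff_distrib[symmetric] abs_mult C_def)
    also have "\<dots> \<le> C * (norm (u - v) * r powr (- 1/2) * exp (- a\<^sup>2 / 4))"
      by (intro mult_left_mono 1) (simp add: C_def)
    also have "\<dots> = 2 powr (real CARD('d) / 2) * r powr (- 1/2) * norm (u - v) * gauss_dens (2 * r) u"
      unfolding gauss_dens_def eqs C by simp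
    also have "\<dots> \<le> 2 powr (real CARD('d) / 2) * r powr (- 1/2) * norm (u - v) * (gauss_dens (2 * r) u + gauss_dens (2 * r) v)"
      by (intro mult_left_mono) auto
    finally show ?thesis .
  qed
  show ?thesis
    using main[of u v] main[of v u] by (cases "norm u \<le> norm v") (auto simp: norm_minus_commute abs_minus_commute add.commute)
qed

text \<open>Translation moves \<open>x\<close> from the function into the density. Differences in
  \<open>x\<close> then fall on the smooth kernel, and \<open>f\<close> need only be Borel.\<close>

lemma nn_integral_gauss_vec_shift:
  fixes f :: "real ^ 'd::finite \<Rightarrow> ennreal"
  assumes [measurable]: "f \<in> borel_measurable borel"
  shows "(\<integral>\<^sup>+ w. f (x + w) \<partial>gauss_vec r) = (\<integral>\<^sup>+ z. ennreal (gauss_dens r (z - x)) * f z \<partial>lborel)"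
proof -
  have "(\<integral>\<^sup>+ z. ennreal (gauss_dens r (z - x)) * f z \<partial>lborel)
      = (\<integral>\<^sup>+ z. ennreal (gauss_dens r (z - x)) * f z \<partial>distr lborel borel ((+) x))"
    by (simp add: lborel_distr_plus)
  also have "\<dots> = (\<integral>\<^sup>+ w. ennreal (gauss_dens r w) * f (x + w) \<partial>lborel)"
    by (subst nn_integral_distr) auto
  finally show ?thesis
    unfolding gauss_vec_eq_density by (subst nn_integral_density) auto
qed

lemma integral_gauss_vec_shift:
  fixes f :: "real ^ 'd::finite \<Rightarrow> real"
  assumes [measurable]: "f \<in> borel_measurable borel"
  shows "(\<integral> w. f (x + w) \<partial>gauss_vec r) = (\<integral> z. gauss_dens r (z - x) * f z \<partial>lborel)"
proof -
  have "(\<integral> z. gauss_dens r (z - x) * f z \<partial>lborel)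
      = (\<integral> z. gauss_dens r (z - x) * f z \<partial>distr lborel borel ((+) x))"
    by (simp add: lborel_distr_plus)
  also have "\<dots> = (\<integral> w. gauss_dens r w * f (x + w) \<partial>lborel)"
    by (subst integral_distr) auto
  finally show ?thesis
    unfolding gauss_vec_eq_density by (subst integral_density) auto
qed

text \<open>The bound is what a function of norm \<open>N\<close> in \<open>L\<^sub>p\<close> satisfies for \<open>\<kappa> = d / (2 * p)\<close>. Bounded
  functions satisfy it for every \<open>\<kappa>\<close> and Lebesgue-null functions satisfy it with \<open>N = 0\<close>, so that one
  notion covers all values of \<open>p\<close> and the passage to representatives.\<close>

definition heat_bounded :: "real \<Rightarrow> real \<Rightarrow> (real ^ 'd::finite \<Rightarrow> real) \<Rightarrow> bool" where
  "heat_bounded \<kappa> N f \<longleftrightarrow>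
     (\<forall>r>0. \<forall>x. (\<integral>\<^sup>+ w. ennreal \<bar>f (x + w)\<bar> \<partial>gauss_vec r) \<le> ennreal (N * (1 + r powr (- \<kappa>))))"

lemma heat_boundedD:
  "heat_bounded \<kappa> N f \<Longrightarrow> 0 < r \<Longrightarrow> (\<integral>\<^sup>+ w. ennreal \<bar>f (x + w)\<bar> \<partial>gauss_vec r) \<le> ennreal (N * (1 + r powr (- \<kappa>)))"
  by (auto simp: heat_bounded_def)

text \<open>By \<open>gauss_dens_diff_le\<close> the difference is controlled by the averages of the
  absolute value of \<open>f\<close> under the Gaussians of variance \<open>2 * r\<close> at
  \<open>x\<close> and at \<open>y\<close>; these two averages give the factor 2.\<close>

lemma heat_bounded_lipschitz:
  fixes f :: "real ^ 'd::finite \<Rightarrow> real"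
  assumes [measurable]: "f \<in> borel_measurable borel"
    and hb: "heat_bounded \<kappa> N f" and "0 \<le> N" "0 \<le> \<kappa>" "0 < r"
  shows "\<bar>(\<integral> w. f (x + w) \<partial>gauss_vec r) - (\<integral> w. f (y + w) \<partial>gauss_vec r)\<bar>
    \<le> 2 powr (real CARD('d) / 2) * r powr (- 1/2) * norm (x - y) * (2 * (N * (1 + r powr (- \<kappa>))))"
proof -
  define K where "K = 2 powr (real CARD('d) / 2) * r powr (- 1/2) * norm (x - y)"
  have K: "0 \<le> K" by (simp add: K_def)
  \<comment> \<open>\<open>f\<close> may be unbounded. Integrability against the shifted density
    comes from the heat bound and is needed to merge two Bochner integrals into one.\<close>
  have int: "integrable lborel (\<lambda>z. gauss_dens r (z - u) * f z)" for u
  proof (rule integrableI_bounded)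
    have "(\<integral>\<^sup>+ z. ennreal (norm (gauss_dens r (z - u) * f z)) \<partial>lborel) = (\<integral>\<^sup>+ w. ennreal \<bar>f (u + w)\<bar> \<partial>gauss_vec r)"
      by (subst nn_integral_gauss_vec_shift) (auto simp: abs_mult ennreal_mult intro!: nn_integral_cong)
    also have "\<dots> < \<infinity>" using heat_boundedD[OF hb \<open>0 < r\<close>, of u] by (simp add: order_le_less_trans)
    finally show "(\<integral>\<^sup>+ z. ennreal (norm (gauss_dens r (z - u) * f z)) \<partial>lborel) < \<infinity>" .
  qed auto
  \<comment> \<open>The heat bound decreases in the variance because \<kappa> is nonnegative, so the
    averages at \<open>2 * r\<close> obey the bound at \<open>r\<close>.\<close>
  have mono: "N * (1 + (2 * r) powr (- \<kappa>)) \<le> N * (1 + r powr (- \<kappa>))"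
  proof (intro mult_left_mono add_left_mono \<open>0 \<le> N\<close>)
    show "(2 * r) powr - \<kappa> \<le> r powr - \<kappa>"
      using \<open>0 < r\<close> \<open>0 \<le> \<kappa>\<close> by (intro powr_mono2') auto
  qed
  have le2: "(\<integral>\<^sup>+ w. ennreal \<bar>f (u + w)\<bar> \<partial>gauss_vec (2 * r)) \<le> ennreal (N * (1 + r powr (- \<kappa>)))" for u
    by (rule order_trans[OF heat_boundedD[OF hb] ennreal_leI[OF mono]]) (simp add: \<open>0 < r\<close>)
  have dd: "\<bar>gauss_dens r (z - x) - gauss_dens r (z - y)\<bar> \<le> K * (gauss_dens (2 * r) (z - x) + gauss_dens (2 * r) (z - y))" for z
    using gauss_dens_diff_le[OF \<open>0 < r\<close>, of "z - x" "z - y"] by (simp add: K_def norm_minus_commute)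
  have "ennreal \<bar>(\<integral> w. f (x + w) \<partial>gauss_vec r) - (\<integral> w. f (y + w) \<partial>gauss_vec r)\<bar>
      = ennreal (norm (\<integral> z. gauss_dens r (z - x) * f z - gauss_dens r (z - y) * f z \<partial>lborel))"
    by (simp add: integral_gauss_vec_shift int)
  also have "\<dots> \<le> (\<integral>\<^sup>+ z. norm (gauss_dens r (z - x) * f z - gauss_dens r (z - y) * f z) \<partial>lborel)"
    by (intro integral_norm_bound_ennreal Bochner_Integration.integrable_diff int)
  also have "\<dots> \<le> (\<integral>\<^sup>+ z. ennreal K * (ennreal (gauss_dens (2 * r) (z - x)) * ennreal \<bar>f z\<bar>
                  + ennreal (gauss_dens (2 * r) (z - y)) * ennreal \<bar>f z\<bar>) \<partial>lborel)"
  proof (intro nn_integral_mono)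
    fix z
    have "norm (gauss_dens r (z - x) * f z - gauss_dens r (z - y) * f z)
        = \<bar>gauss_dens r (z - x) - gauss_dens r (z - y)\<bar> * \<bar>f z\<bar>"
      by (simp add: left_diff_distrib[symmetric] abs_mult)
    also have "\<dots> \<le> K * (gauss_dens (2 * r) (z - x) + gauss_dens (2 * r) (z - y)) * \<bar>f z\<bar>"
      by (intro mult_right_mono dd) auto
    finally have "ennreal (norm (gauss_dens r (z - x) * f z - gauss_dens r (z - y) * f z))
        \<le> ennreal (K * (gauss_dens (2 * r) (z - x) * \<bar>f z\<bar> + gauss_dens (2 * r) (z - y) * \<bar>f z\<bar>))"
      by (intro ennreal_leI) (simp add: algebra_simps)
    then show "ennreal (norm (gauss_dens r (z - x) * f z - gauss_dens r (z - y) * f z))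
        \<le> ennreal K * (ennreal (gauss_dens (2 * r) (z - x)) * ennreal \<bar>f z\<bar>
                  + ennreal (gauss_dens (2 * r) (z - y)) * ennreal \<bar>f z\<bar>)"
      using K by (simp add: ennreal_mult)
  qed
  also have "\<dots> = ennreal K * ((\<integral>\<^sup>+ w. ennreal \<bar>f (x + w)\<bar> \<partial>gauss_vec (2 * r)) + (\<integral>\<^sup>+ w. ennreal \<bar>f (y + w)\<bar> \<partial>gauss_vec (2 * r)))"
    using nn_integral_gauss_vec_shift[where f = "\<lambda>z. ennreal \<bar>f z\<bar>" and r = "2 * r"]
    by (subst nn_integral_cmult) (auto simp: nn_integral_add)
  also have "\<dots> \<le> ennreal K * (ennreal (N * (1 + r powr (- \<kappa>))) + ennreal (N * (1 + r powr (- \<kappa>))))"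
    by (intro mult_left_mono add_mono le2) simp
  also have "\<dots> = ennreal (K * (2 * (N * (1 + r powr (- \<kappa>)))))"
  proof -
    have "0 \<le> N * (1 + r powr (- \<kappa>))" using \<open>0 \<le> N\<close> by simp
    then show ?thesis
      using K by (subst mult_2, subst ennreal_mult) (simp_all only: ennreal_plus add_nonneg_nonneg)
  qed
  finally have "\<bar>(\<integral> w. f (x + w) \<partial>gauss_vec r) - (\<integral> w. f (y + w) \<partial>gauss_vec r)\<bar>
      \<le> K * (2 * (N * (1 + r powr (- \<kappa>))))"
    using \<open>0 \<le> N\<close> K by (subst (asm) ennreal_le_iff) simp_all
  then show ?thesis by (simp only: K_def)
qed

text \<open>Gaussian laws have Lebesgue densities and do not see null sets. Their mass is 1 by the
  premise \<open>ps\<close>, which is discharged later by realising them as laws of a Wiener process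
  instead of evaluating the Gaussian integral.\<close>

lemma heat_bounded_of_AE_le:
  fixes g :: "real ^ 'd::finite \<Rightarrow> real"
  assumes [measurable]: "g \<in> borel_measurable borel" and le: "AE z in lborel. \<bar>g z\<bar> \<le> m" and "0 \<le> m"
    and ps: "\<And>r. 0 < r \<Longrightarrow> prob_space (gauss_vec r :: (real ^ 'd) measure)"
  shows "heat_bounded \<kappa> m g"
  unfolding heat_bounded_def
proof (intro allI impI)
  fix r :: real and x :: "real ^ 'd" assume r: "0 < r"
  interpret prob_space "gauss_vec r :: (real ^ 'd) measure" by (rule ps[OF r])
  have "(\<integral>\<^sup>+ w. ennreal \<bar>g (x + w)\<bar> \<partial>gauss_vec r) = (\<integral>\<^sup>+ z. ennreal (gauss_dens r (z - x)) * ennreal \<bar>g z\<bar> \<partial>lborel)"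
    by (rule nn_integral_gauss_vec_shift) measurable
  also have "\<dots> \<le> (\<integral>\<^sup>+ z. ennreal (gauss_dens r (z - x)) * ennreal m \<partial>lborel)"
    using le by (intro nn_integral_mono_AE) (auto elim!: eventually_mono intro!: mult_left_mono ennreal_leI)
  also have "\<dots> = (\<integral>\<^sup>+ w. ennreal m \<partial>(gauss_vec r :: (real ^ 'd) measure))"
    by (rule nn_integral_gauss_vec_shift[symmetric]) measurable
  also have "\<dots> = ennreal m"
    using emeasure_space_1 by simp
  also have "\<dots> \<le> ennreal (m * (1 + r powr - \<kappa>))"
    using \<open>0 \<le> m\<close> by (intro ennreal_leI) (simp add: distrib_left)
  finally show "(\<integral>\<^sup>+ w. ennreal \<bar>g (x + w)\<bar> \<partial>gauss_vec r) \<le> ennreal (m * (1 + r powr - \<kappa>))" .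
qed

section \<open>Subordinated Brownian motion\<close>

lemma gauss_dens_measurable_pair [measurable (raw)]:
  assumes [measurable]: "g \<in> borel_measurable M" "h \<in> borel_measurable M"
  shows "(\<lambda>x. gauss_dens (g x) (h x)) \<in> borel_measurable M"
  unfolding gauss_dens_def by measurable

lemma nn_integral_gauss_vec:
  fixes f :: "real ^ 'd::finite \<Rightarrow> ennreal"
  assumes [measurable]: "f \<in> borel_measurable borel"
  shows "(\<integral>\<^sup>+ w. f w \<partial>gauss_vec r) = (\<integral>\<^sup>+ z. ennreal (gauss_dens r z) * f z \<partial>lborel)"
  using nn_integral_gauss_vec_shift[where f = f and x = 0 and r = r] by simp

lemma measurable_proc_sigma:
  assumes N: "space N = space M" "sets N = proc_sigma M Y" and "0 \<le> t"
  shows "Y t \<in> borel_measurable N"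
proof (rule measurableI)
  fix A :: "'b set" assume "A \<in> sets borel"
  then show "Y t -` A \<inter> space N \<in> sets N"
    unfolding N proc_sigma_def using \<open>0 \<le> t\<close>
    by (intro sigma_sets.Basic CollectI exI[of _ t] exI[of _ A]) simp
qed simp

text \<open>Joint measurability follows from continuity of the paths by rounding time to a countable
  grid. Time is cut off at 0 because path continuity is given only on \<open>{0..}\<close>. The
  sample space carries the \<sigma>-algebra generated by \<open>W\<close> alone, which can be
  independent of \<open>T\<close>.\<close>

lemma wiener_measurable_pair:
  fixes W :: "real \<Rightarrow> 'a \<Rightarrow> real ^ 'd::finite"
  assumes W: "wiener_process M W"
    and N: "space N = space M" "sets N = proc_sigma M W"
  shows "(\<lambda>(r, \<omega>). W (max 0 r) \<omega>) \<in> borel_measurable (borel \<Otimes>\<^sub>M N)"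
proof -
  have cont: "continuous_on {0..} (\<lambda>t. W t \<omega>)" if "\<omega> \<in> space M" for \<omega>
    using W that by (auto simp: wiener_process_def)
  \<comment> \<open>\<open>g i r\<close> rounds \<open>max 0 r\<close> up to the grid of mesh
    \<open>1 / Suc i\<close>, so it stays in the half-line on which the paths are
    continuous.\<close>
  define g where "g i r = real (nat \<lceil>max 0 r * Suc i\<rceil>) / real (Suc i)" for i :: nat and r :: real
  have g: "0 \<le> g i r" "max 0 r \<le> g i r" "g i r \<le> max 0 r + 1 / Suc i" for i r
  proof -
    have "0 \<le> max 0 r * Suc i" by simp
    then have 1: "real (nat \<lceil>max 0 r * Suc i\<rceil>) = of_int \<lceil>max 0 r * Suc i\<rceil>"
      by (metis ceiling_mono ceiling_zero of_nat_nat)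
    show "0 \<le> g i r" unfolding g_def by (intro divide_nonneg_nonneg of_nat_0_le_iff)
    show "max 0 r \<le> g i r"
      unfolding g_def 1 using le_of_int_ceiling[of "max 0 r * Suc i"] by (subst pos_le_divide_eq) simp_all
    have "of_int \<lceil>max 0 r * Suc i\<rceil> \<le> max 0 r * Suc i + 1" by linarith
    then show "g i r \<le> max 0 r + 1 / Suc i"
      unfolding g_def 1 by (simp add: divide_simps mult.commute)
  qed
  have glim: "(\<lambda>i. g i r) \<longlonglongrightarrow> max 0 r" for r
  proof (rule tendsto_sandwich[of "\<lambda>_. max 0 r" _ _ "\<lambda>i. max 0 r + 1 / Suc i"])
    show "(\<lambda>i. max 0 r + 1 / real (Suc i)) \<longlonglongrightarrow> max 0 r"
      using tendsto_add[OF tendsto_const LIMSEQ_inverse_real_of_nat, of "max 0 r"] by (simp add: inverse_eq_divide)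
  qed (use g in auto)
  show ?thesis
  proof (rule borel_measurable_LIMSEQ_metric)
    fix i
    have *: "(\<lambda>x. W (real k / real (Suc i)) (snd x)) \<in> borel_measurable (borel \<Otimes>\<^sub>M N)" for k
      by (intro measurable_compose[OF measurable_snd measurable_proc_sigma[OF N]]) simp
    have [measurable]: "(\<lambda>x. nat \<lceil>max 0 (fst x) * real (Suc i)\<rceil>) \<in> measurable (borel \<Otimes>\<^sub>M N) (count_space UNIV)"
      by measurable
    have "(\<lambda>x. W (real (nat \<lceil>max 0 (fst x) * real (Suc i)\<rceil>) / real (Suc i)) (snd x)) \<in> borel_measurable (borel \<Otimes>\<^sub>M N)"
      by (rule measurable_compose_countable[where f = "\<lambda>k x. W (real k / real (Suc i)) (snd x)", OF *]) measurable
    then show "(\<lambda>(r, \<omega>). W (g i r) \<omega>) \<in> borel_measurable (borel \<Otimes>\<^sub>M N)"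
      by (simp add: g_def split_beta')
  next
    fix x :: "real \<times> 'a" assume "x \<in> space (borel \<Otimes>\<^sub>M N)"
    then have "snd x \<in> space M" by (auto simp: space_pair_measure N)
    from continuous_on_tendsto_compose[OF cont[OF this] glim[of "fst x"]] g
    show "(\<lambda>i. case x of (r, \<omega>) \<Rightarrow> W (g i r) \<omega>) \<longlonglongrightarrow> (case x of (r, \<omega>) \<Rightarrow> W (max 0 r) \<omega>)"
      by (auto simp: split_beta')
  qed
qed

lemma wiener_distr:
  assumes W: "wiener_process M W" and "0 < r"
  shows "distr M borel (W r) = gauss_vec r"
proof -
  have "distr M borel (\<lambda>\<omega>. W r \<omega> - W 0 \<omega>) = gauss_vec (r - 0)"
    using W \<open>0 < r\<close> unfolding wiener_process_def by blast
  moreover have "distr M borel (\<lambda>\<omega>. W r \<omega> - W 0 \<omega>) = distr M borel (W r)"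
    using W by (intro distr_cong) (auto simp: wiener_process_def)
  ultimately show ?thesis by simp
qed

text \<open>Independence makes the law of the pair of \<open>T t \<omega>\<close> and \<omega> a
  product. Fubini then freezes the random time, and \<open>W r\<close> has law
  \<open>gauss_vec r\<close> for each fixed \<open>r > 0\<close>.\<close>

lemma wiener_subordinated:
  fixes W :: "real \<Rightarrow> 'a \<Rightarrow> real ^ 'd::finite"
  assumes W: "wiener_process M W" and T: "subordinator M T"
    and ind: "prob_space.indep_set M (proc_sigma M W) (proc_sigma M T)"
    and "0 < t"
  shows wiener_subordinated_measurable: "(\<lambda>\<omega>. W (T t \<omega>) \<omega>) \<in> borel_measurable M"
    and nn_integral_wiener_subordinated: "f \<in> borel_measurable borel \<Longrightarrow>
      (\<integral>\<^sup>+ \<omega>. f (W (T t \<omega>) \<omega>) \<partial>M) = (\<integral>\<^sup>+ \<omega>. (\<integral>\<^sup>+ w. f w \<partial>gauss_vec (T t \<omega>)) \<partial>M)"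
proof -
  interpret prob_space M using W by (simp add: wiener_process_def)
  define gen where "gen = {W t -` A \<inter> space M | t A. 0 \<le> t \<and> A \<in> sets borel}"
  define N where "N = sigma (space M) gen"
  have gen: "gen \<subseteq> Pow (space M)" by (auto simp: gen_def)
  have N: "space N = space M" "sets N = proc_sigma M W"
    using gen by (auto simp: N_def proc_sigma_def gen_def)
  have Wm [measurable]: "W t \<in> borel_measurable M" for t using W by (auto simp: wiener_process_def)
  have Tm [measurable]: "T t \<in> borel_measurable M" for t using T by (auto simp: subordinator_def)
  have Tpos: "0 < T t \<omega>" if "\<omega> \<in> space M" for \<omega>
    using T that \<open>0 < t\<close> by (auto simp: subordinator_def)
  note Phi [measurable] = wiener_measurable_pair[OF W N]
  have sub: "sets N \<subseteq> sets M"
    unfolding N_def sets_measure_of[OF gen] by (intro sets.sigma_sets_subset) (auto simp: gen_def)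
  have idm [measurable]: "(\<lambda>\<omega>. \<omega>) \<in> measurable M N"
    using sub N by (auto intro!: measurableI dest: sets.sets_into_space simp: subset_iff Int_absorb2)
  have prod: "prob (a \<inter> b) = prob a * prob b" if "a \<in> proc_sigma M T" "b \<in> proc_sigma M W" for a b
    using indep_setD[OF ind that(2) that(1)] by (simp add: Int_commute mult.commute)
  \<comment> \<open>The sample point itself, observed only through \<open>N\<close>, stands in for
    the path of \<open>W\<close>; no path space has to be built.\<close>
  have joint: "distr M borel (T t) \<Otimes>\<^sub>M distr M N (\<lambda>\<omega>. \<omega>) = distr M (borel \<Otimes>\<^sub>M N) (\<lambda>\<omega>. (T t \<omega>, \<omega>))"
  proof (rule pair_measure_eqI)
    fix A B assume "A \<in> sets (distr M borel (T t))" "B \<in> sets (distr M N (\<lambda>\<omega>. \<omega>))"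
    then have AB [measurable]: "A \<in> sets borel" "B \<in> sets N" by auto
    then have B: "B \<subseteq> space M" "B \<in> proc_sigma M W"
      using sets.sets_into_space[of B N] N by auto
    have A: "T t -` A \<inter> space M \<in> proc_sigma M T"
      unfolding proc_sigma_def using AB \<open>0 < t\<close> by (intro sigma_sets.Basic CollectI exI[of _ t] exI[of _ A]) auto
    have "emeasure (distr M borel (T t)) A * emeasure (distr M N (\<lambda>\<omega>. \<omega>)) B
        = emeasure M (T t -` A \<inter> space M) * emeasure M B"
      using B by (simp add: emeasure_distr Int_absorb2)
    also have "\<dots> = emeasure M ((T t -` A \<inter> space M) \<inter> B)"
      using prod[OF A B(2)] by (simp add: emeasure_eq_measure ennreal_mult)
    also have "(T t -` A \<inter> space M) \<inter> B = (\<lambda>\<omega>. (T t \<omega>, \<omega>)) -` (A \<times> B) \<inter> space M"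
      using B by auto
    also have "emeasure M \<dots> = emeasure (distr M (borel \<Otimes>\<^sub>M N) (\<lambda>\<omega>. (T t \<omega>, \<omega>))) (A \<times> B)"
      by (subst emeasure_distr) auto
    finally show "emeasure (distr M borel (T t)) A * emeasure (distr M N (\<lambda>\<omega>. \<omega>)) B
        = emeasure (distr M (borel \<Otimes>\<^sub>M N) (\<lambda>\<omega>. (T t \<omega>, \<omega>))) (A \<times> B)" .
  qed (auto intro!: prob_space_imp_sigma_finite prob_space_distr cong: sets_pair_measure_cong)
  have eq: "W (T t \<omega>) \<omega> = (case (T t \<omega>, \<omega>) of (r, \<omega>) \<Rightarrow> W (max 0 r) \<omega>)" if "\<omega> \<in> space M" for \<omega>
    using Tpos[OF that] by (simp add: max_def)
  show "(\<lambda>\<omega>. W (T t \<omega>) \<omega>) \<in> borel_measurable M"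
  proof (subst measurable_cong[OF eq])
    show "(\<lambda>\<omega>. case (T t \<omega>, \<omega>) of (r, \<omega>) \<Rightarrow> W (max 0 r) \<omega>) \<in> borel_measurable M"
      by (rule measurable_compose[OF _ Phi]) measurable
  qed
  assume f [measurable]: "f \<in> borel_measurable borel"
  note fPhi = measurable_compose[OF Phi f]
  interpret N: prob_space "distr M N (\<lambda>\<omega>. \<omega>)" by (rule prob_space_distr) measurable
  have "(\<integral>\<^sup>+ \<omega>. f (W (T t \<omega>) \<omega>) \<partial>M) = (\<integral>\<^sup>+ \<omega>. f (case (T t \<omega>, \<omega>) of (r, \<omega>) \<Rightarrow> W (max 0 r) \<omega>) \<partial>M)"
    by (intro nn_integral_cong) (simp only: eq)
  also have "\<dots> = (\<integral>\<^sup>+ p. f (case p of (r, \<omega>) \<Rightarrow> W (max 0 r) \<omega>) \<partial>distr M (borel \<Otimes>\<^sub>M N) (\<lambda>\<omega>. (T t \<omega>, \<omega>)))"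
    by (subst nn_integral_distr) (use fPhi in auto)
  also have "\<dots> = (\<integral>\<^sup>+ p. f (case p of (r, \<omega>) \<Rightarrow> W (max 0 r) \<omega>) \<partial>(distr M borel (T t) \<Otimes>\<^sub>M distr M N (\<lambda>\<omega>. \<omega>)))"
    by (simp only: joint)
  also have "\<dots> = (\<integral>\<^sup>+ r. \<integral>\<^sup>+ \<omega>. f (W (max 0 r) \<omega>) \<partial>distr M N (\<lambda>\<omega>. \<omega>) \<partial>distr M borel (T t))"
    using fPhi by (subst N.nn_integral_fst[symmetric]) (simp_all add: split_beta' cong: measurable_cong_sets sets_pair_measure_cong)
  also have "\<dots> = (\<integral>\<^sup>+ \<omega>'. \<integral>\<^sup>+ \<omega>. f (W (max 0 (T t \<omega>')) \<omega>) \<partial>distr M N (\<lambda>\<omega>. \<omega>) \<partial>M)"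
  proof -
    have "(\<lambda>r. \<integral>\<^sup>+ \<omega>. f (W (max 0 r) \<omega>) \<partial>distr M N (\<lambda>\<omega>. \<omega>)) \<in> borel_measurable borel"
      using fPhi by (intro N.borel_measurable_nn_integral) (simp add: split_beta' cong: measurable_cong_sets sets_pair_measure_cong)
    then show ?thesis by (subst nn_integral_distr) auto
  qed
  also have "\<dots> = (\<integral>\<^sup>+ \<omega>'. \<integral>\<^sup>+ w. f w \<partial>gauss_vec (T t \<omega>') \<partial>M)"
  proof (intro nn_integral_cong)
    fix \<omega>' assume "\<omega>' \<in> space M"
    then have pos: "0 < T t \<omega>'" by (rule Tpos)
    then have "W (T t \<omega>') \<in> borel_measurable N"
      by (intro measurable_proc_sigma[OF N]) simp
    then have "(\<integral>\<^sup>+ \<omega>. f (W (max 0 (T t \<omega>')) \<omega>) \<partial>distr M N (\<lambda>\<omega>. \<omega>)) = (\<integral>\<^sup>+ \<omega>. f (W (T t \<omega>') \<omega>) \<partial>M)"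
      using pos by (subst nn_integral_distr) (auto simp: max_def)
    also have "\<dots> = (\<integral>\<^sup>+ w. f w \<partial>distr M borel (W (T t \<omega>')))"
      by (subst nn_integral_distr) auto
    finally show "(\<integral>\<^sup>+ \<omega>. f (W (max 0 (T t \<omega>')) \<omega>) \<partial>distr M N (\<lambda>\<omega>. \<omega>)) = (\<integral>\<^sup>+ w. f w \<partial>gauss_vec (T t \<omega>'))"
      by (simp add: wiener_distr[OF W pos])
  qed
  finally show "(\<integral>\<^sup>+ \<omega>. f (W (T t \<omega>) \<omega>) \<partial>M) = (\<integral>\<^sup>+ \<omega>. (\<integral>\<^sup>+ w. f w \<partial>gauss_vec (T t \<omega>)) \<partial>M)" .
qed

text \<open>The increments over \<open>[0, s]\<close> and \<open>[s, s + t]\<close> are independent,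
  so the law of \<open>Y (s + t)\<close> is a convolution. This serves both the Wiener process and
  the subordinator.\<close>

lemma indep_increments_nn_integral:
  fixes Y :: "real \<Rightarrow> 'a \<Rightarrow> 'b::{real_normed_vector,second_countable_topology}"
  assumes "prob_space M" and ind: "indep_increments M Y" and Y0: "\<And>\<omega>. \<omega> \<in> space M \<Longrightarrow> Y 0 \<omega> = 0"
    and [measurable]: "\<And>t. Y t \<in> borel_measurable M" "f \<in> borel_measurable borel"
    and "0 < s" "0 < t"
  shows "(\<integral>\<^sup>+ \<omega>. f (Y (s + t) \<omega>) \<partial>M)
    = (\<integral>\<^sup>+ y. \<integral>\<^sup>+ z. f (y + z) \<partial>distr M borel (\<lambda>\<omega>. Y (s + t) \<omega> - Y s \<omega>) \<partial>distr M borel (Y s))"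
proof -
  interpret prob_space M by fact
  \<comment> \<open>Only the values at 0, 1 and 2 matter: they produce the two increments indexed by
    \<open>{..<2}\<close>.\<close>
  define ts where "ts = (\<lambda>i::nat. if i = 0 then 0 else if i = 1 then s else s + t)"
  have "indep_vars (\<lambda>_. borel) (\<lambda>i \<omega>. Y (ts (Suc i)) \<omega> - Y (ts i) \<omega>) {..<2::nat}"
  proof -
    have "0 \<le> ts 0 \<and> (\<forall>i<2. ts i < ts (Suc i))"
      using \<open>0 < s\<close> \<open>0 < t\<close> by (auto simp: ts_def less_2_cases_iff)
    with ind show ?thesis unfolding indep_increments_def by blast
  qed
  from indep_var_restrict[OF this, of "{0}" "{1}"]
  have "indep_var (PiM {0} (\<lambda>_. borel)) (\<lambda>\<omega>. \<lambda>i\<in>{0}. Y (ts (Suc i)) \<omega> - Y (ts i) \<omega>)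
      (PiM {1::nat} (\<lambda>_. borel)) (\<lambda>\<omega>. \<lambda>i\<in>{1}. Y (ts (Suc i)) \<omega> - Y (ts i) \<omega>)"
    by auto
  from indep_var_compose[OF this, of "\<lambda>g. g 0" borel "\<lambda>g. g 1" borel]
  have "indep_var borel (\<lambda>\<omega>. Y (ts (Suc 0)) \<omega> - Y (ts 0) \<omega>) borel (\<lambda>\<omega>. Y (ts (Suc 1)) \<omega> - Y (ts 1) \<omega>)"
    by (simp add: comp_def)
  then have "distr M borel (\<lambda>\<omega>. Y s \<omega> - Y 0 \<omega>) \<Otimes>\<^sub>M distr M borel (\<lambda>\<omega>. Y (s + t) \<omega> - Y s \<omega>)
     = distr M (borel \<Otimes>\<^sub>M borel) (\<lambda>\<omega>. (Y s \<omega> - Y 0 \<omega>, Y (s + t) \<omega> - Y s \<omega>))"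
    unfolding indep_var_distribution_eq by (simp add: ts_def)
  moreover have "distr M borel (\<lambda>\<omega>. Y s \<omega> - Y 0 \<omega>) = distr M borel (Y s)"
    by (intro distr_cong) (auto simp: Y0)
  ultimately have joint: "distr M borel (Y s) \<Otimes>\<^sub>M distr M borel (\<lambda>\<omega>. Y (s + t) \<omega> - Y s \<omega>)
     = distr M (borel \<Otimes>\<^sub>M borel) (\<lambda>\<omega>. (Y s \<omega> - Y 0 \<omega>, Y (s + t) \<omega> - Y s \<omega>))" by simp
  interpret D: prob_space "distr M borel (\<lambda>\<omega>. Y (s + t) \<omega> - Y s \<omega>)" by (rule prob_space_distr) measurable
  have "(\<integral>\<^sup>+ y. \<integral>\<^sup>+ z. f (y + z) \<partial>distr M borel (\<lambda>\<omega>. Y (s + t) \<omega> - Y s \<omega>) \<partial>distr M borel (Y s))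
     = (\<integral>\<^sup>+ p. f (fst p + snd p) \<partial>(distr M borel (Y s) \<Otimes>\<^sub>M distr M borel (\<lambda>\<omega>. Y (s + t) \<omega> - Y s \<omega>)))"
    by (subst D.nn_integral_fst[symmetric]) auto
  also have "\<dots> = (\<integral>\<^sup>+ \<omega>. f (Y (s + t) \<omega>) \<partial>M)"
    unfolding joint by (subst nn_integral_distr) (auto intro!: nn_integral_cong simp: Y0)
  finally show ?thesis ..
qed

text \<open>Additivity of the variance is read off from the independent increments of a Wiener
  process; no convolution of densities is computed.\<close>

lemma nn_integral_gauss_vec_add:
  fixes f :: "real ^ 'd::finite \<Rightarrow> ennreal"
  assumes W: "wiener_process M (W :: real \<Rightarrow> 'a \<Rightarrow> real ^ 'd)"
    and [measurable]: "f \<in> borel_measurable borel" and ab: "0 < a" "0 < b"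
  shows "(\<integral>\<^sup>+ w. f w \<partial>gauss_vec (a + b)) = (\<integral>\<^sup>+ y. \<integral>\<^sup>+ z. f (y + z) \<partial>gauss_vec b \<partial>gauss_vec a)"
proof -
  have Wm [measurable]: "W t \<in> borel_measurable M" for t using W by (auto simp: wiener_process_def)
  have "distr M borel (\<lambda>\<omega>. W (a + b) \<omega> - W a \<omega>) = gauss_vec (a + b - a)"
    using W ab by (simp add: wiener_process_def)
  then have inc: "distr M borel (\<lambda>\<omega>. W (a + b) \<omega> - W a \<omega>) = gauss_vec b" by simp
  have "(\<integral>\<^sup>+ w. f w \<partial>gauss_vec (a + b)) = (\<integral>\<^sup>+ \<omega>. f (W (a + b) \<omega>) \<partial>M)"
    using ab by (simp add: wiener_distr[OF W, symmetric] nn_integral_distr)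
  also have "\<dots> = (\<integral>\<^sup>+ y. \<integral>\<^sup>+ z. f (y + z) \<partial>gauss_vec b \<partial>gauss_vec a)"
    using W ab inc wiener_distr[OF W, of a]
    by (subst indep_increments_nn_integral) (auto simp: wiener_process_def)
  finally show ?thesis .
qed

lemma prob_space_gauss_vec:
  assumes "wiener_process M (W :: real \<Rightarrow> 'a \<Rightarrow> real ^ 'd::finite)" "0 < r"
  shows "prob_space (gauss_vec r :: (real ^ 'd) measure)"
proof -
  interpret prob_space M using assms(1) by (simp add: wiener_process_def)
  have "W r \<in> borel_measurable M" using assms(1) by (simp add: wiener_process_def)
  from prob_space_distr[OF this] show ?thesis by (simp add: wiener_distr[OF assms])
qed

section \<open>The law of the subordinated Wiener process\<close>

lemma same_fdd_distr:
  assumes fdd: "same_fdd M T N S" and "0 \<le> t"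
    and [measurable]: "T t \<in> borel_measurable M" "S t \<in> borel_measurable N"
  shows "distr M borel (T t) = distr N borel (S t)"
proof -
  let ?P = "PiM {..<1::nat} (\<lambda>_. borel :: real measure)"
  have eq: "distr M ?P (\<lambda>\<omega>. \<lambda>i\<in>{..<1}. T t \<omega>) = distr N ?P (\<lambda>\<omega>. \<lambda>i\<in>{..<1}. S t \<omega>)"
    using fdd[unfolded same_fdd_def, rule_format, of 1 "\<lambda>_. t"] \<open>0 \<le> t\<close> by simp
  have "distr M borel (T t) = distr (distr M ?P (\<lambda>\<omega>. \<lambda>i\<in>{..<1}. T t \<omega>)) borel (\<lambda>g. g 0)"
    by (subst distr_distr) (auto simp: comp_def)
  also have "\<dots> = distr N borel (S t)"
    unfolding eq by (subst distr_distr) (auto simp: comp_def)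
  finally show ?thesis .
qed

text \<open>The Gaussian mixture over \<open>T t\<close>, that is, the law of \<open>W\<close> at
  time \<open>T t\<close> when \<open>W\<close> and \<open>T\<close> are independent. Written as a
  Lebesgue density, it depends only on the law of \<open>T t\<close>, so all solutions share it
  although they live on different probability spaces.\<close>

definition subord_law :: "'b measure \<Rightarrow> (real \<Rightarrow> 'b \<Rightarrow> real) \<Rightarrow> real \<Rightarrow> (real ^ 'd::finite) measure" where
  "subord_law M T t = density lborel (\<lambda>z. \<integral>\<^sup>+ \<omega>. ennreal (gauss_dens (T t \<omega>) z) \<partial>M)"

lemma sets_subord_law [simp, measurable_cong]: "sets (subord_law M T t) = sets borel"
  by (simp add: subord_law_def)

lemma space_subord_law [simp]: "space (subord_law M T t) = UNIV"
  by (simp add: subord_law_def)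

lemma nn_integral_subord_law:
  fixes f :: "real ^ 'd::finite \<Rightarrow> ennreal"
  assumes T: "subordinator M T" and [measurable]: "f \<in> borel_measurable borel"
  shows "(\<integral>\<^sup>+ w. f w \<partial>subord_law M T t) = (\<integral>\<^sup>+ \<omega>. \<integral>\<^sup>+ w. f w \<partial>gauss_vec (T t \<omega>) \<partial>M)"
proof -
  interpret prob_space M using T by (simp add: subordinator_def)
  interpret pair_sigma_finite M "lborel :: (real ^ 'd) measure" ..
  have Tm [measurable]: "T t \<in> borel_measurable M" for t using T by (auto simp: subordinator_def)
  have "(\<integral>\<^sup>+ w. f w \<partial>subord_law M T t) = (\<integral>\<^sup>+ z. (\<integral>\<^sup>+ \<omega>. ennreal (gauss_dens (T t \<omega>) z) \<partial>M) * f z \<partial>lborel)"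
    unfolding subord_law_def by (subst nn_integral_density) auto
  also have "\<dots> = (\<integral>\<^sup>+ z. \<integral>\<^sup>+ \<omega>. ennreal (gauss_dens (T t \<omega>) z) * f z \<partial>M \<partial>lborel)"
    by (subst nn_integral_multc) auto
  also have "\<dots> = (\<integral>\<^sup>+ \<omega>. \<integral>\<^sup>+ z. ennreal (gauss_dens (T t \<omega>) z) * f z \<partial>lborel \<partial>M)"
    by (rule Fubini') measurable
  finally show ?thesis by (simp add: nn_integral_gauss_vec)
qed

lemma subord_law_cong:
  assumes T: "subordinator M T" and S: "subordinator N S"
    and fdd: "same_fdd M T N S" and "0 \<le> t"
  shows "subord_law M T t = subord_law N S t"
proof -
  have [measurable]: "T t \<in> borel_measurable M" "S t \<in> borel_measurable N"
    using T S by (auto simp: subordinator_def)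
  have eq: "(\<integral>\<^sup>+ \<omega>. ennreal (gauss_dens (T t \<omega>) z) \<partial>M) = (\<integral>\<^sup>+ \<omega>. ennreal (gauss_dens (S t \<omega>) z) \<partial>N)" for z :: "real ^ 'd"
  proof -
    have "(\<integral>\<^sup>+ \<omega>. ennreal (gauss_dens (T t \<omega>) z) \<partial>M) = (\<integral>\<^sup>+ r. ennreal (gauss_dens r z) \<partial>distr M borel (T t))"
      by (subst nn_integral_distr) auto
    also have "\<dots> = (\<integral>\<^sup>+ r. ennreal (gauss_dens r z) \<partial>distr N borel (S t))"
      using same_fdd_distr[OF fdd \<open>0 \<le> t\<close>] by simp
    also have "\<dots> = (\<integral>\<^sup>+ \<omega>. ennreal (gauss_dens (S t \<omega>) z) \<partial>N)"
      by (subst nn_integral_distr) auto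
    finally show ?thesis .
  qed
  show ?thesis unfolding subord_law_def eq ..
qed

lemma distr_wiener_subordinated:
  fixes W :: "real \<Rightarrow> 'a \<Rightarrow> real ^ 'd::finite"
  assumes W: "wiener_process M W" and T: "subordinator M T"
    and ind: "prob_space.indep_set M (proc_sigma M W) (proc_sigma M T)"
    and "0 < t"
  shows "distr M borel (\<lambda>\<omega>. W (T t \<omega>) \<omega>) = subord_law M T t"
proof (rule measure_eqI)
  note [measurable] = wiener_subordinated_measurable[OF assms]
  fix A assume "A \<in> sets (distr M borel (\<lambda>\<omega>. W (T t \<omega>) \<omega>))"
  then have [measurable]: "A \<in> sets borel" by simp
  have "emeasure (distr M borel (\<lambda>\<omega>. W (T t \<omega>) \<omega>)) A = (\<integral>\<^sup>+ w. indicator A w \<partial>distr M borel (\<lambda>\<omega>. W (T t \<omega>) \<omega>))"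
    by simp
  also have "\<dots> = (\<integral>\<^sup>+ \<omega>. indicator A (W (T t \<omega>) \<omega>) \<partial>M)"
    by (subst nn_integral_distr) auto
  also have "\<dots> = (\<integral>\<^sup>+ w. indicator A w \<partial>subord_law M T t)"
    using nn_integral_wiener_subordinated[OF assms, of "indicator A"] nn_integral_subord_law[OF T, of "indicator A" t]
    by (simp del: nn_integral_indicator)
  finally show "emeasure (distr M borel (\<lambda>\<omega>. W (T t \<omega>) \<omega>)) A = emeasure (subord_law M T t) A"
    by simp
qed simp

text \<open>The independent increments of \<open>T\<close> replace \<open>T (s + t)\<close> by a sum
  of independent copies of \<open>T s\<close> and \<open>T t\<close>. For fixed values of these the
  Gaussian variances add.\<close>

lemma subord_law_add:
  fixes f :: "real ^ 'd::finite \<Rightarrow> ennreal"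
  assumes W: "wiener_process N (W :: real \<Rightarrow> 'a \<Rightarrow> real ^ 'd)" and T: "subordinator M T"
    and [measurable]: "f \<in> borel_measurable borel" and st: "0 < s" "0 < t"
  shows "(\<integral>\<^sup>+ w. f w \<partial>subord_law M T (s + t))
    = (\<integral>\<^sup>+ y. \<integral>\<^sup>+ z. f (y + z) \<partial>subord_law M T t \<partial>subord_law M T s)"
proof -
  interpret prob_space M using T by (simp add: subordinator_def)
  have Tm [measurable]: "T t \<in> borel_measurable M" for t using T by (auto simp: subordinator_def)
  have Tpos: "0 < T t \<omega>" if "\<omega> \<in> space M" "0 < t" for \<omega> t
    using T that by (auto simp: subordinator_def)
  have inc: "distr M borel (\<lambda>\<omega>. T (s + t) \<omega> - T s \<omega>) = distr M borel (T t)"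
    using T st by (simp add: subordinator_def)
  define G where "G r = (\<integral>\<^sup>+ z. ennreal (gauss_dens r z) * f z \<partial>lborel)" for r
  have G: "G r = (\<integral>\<^sup>+ w. f w \<partial>gauss_vec r)" for r
    by (simp add: G_def nn_integral_gauss_vec)
  have [measurable]: "G \<in> borel_measurable borel" unfolding G_def by measurable
  have "(\<integral>\<^sup>+ w. f w \<partial>subord_law M T (s + t)) = (\<integral>\<^sup>+ \<omega>. G (T (s + t) \<omega>) \<partial>M)"
    by (simp add: nn_integral_subord_law[OF T] G)
  also have "\<dots> = (\<integral>\<^sup>+ a. \<integral>\<^sup>+ b. G (a + b) \<partial>distr M borel (T t) \<partial>distr M borel (T s))"
    using T st by (subst indep_increments_nn_integral) (auto simp: inc subordinator_def)
  also have "\<dots> = (\<integral>\<^sup>+ \<omega>. \<integral>\<^sup>+ \<omega>'. G (T s \<omega> + T t \<omega>') \<partial>M \<partial>M)"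
    by (simp add: nn_integral_distr)
  also have "\<dots> = (\<integral>\<^sup>+ \<omega>. \<integral>\<^sup>+ y. \<integral>\<^sup>+ z. f (y + z) \<partial>subord_law M T t \<partial>gauss_vec (T s \<omega>) \<partial>M)"
  proof (intro nn_integral_cong)
    fix \<omega> assume \<omega>: "\<omega> \<in> space M"
    interpret g: prob_space "gauss_vec (T s \<omega>) :: (real ^ 'd) measure"
      by (rule prob_space_gauss_vec[OF W Tpos[OF \<omega> st(1)]])
    interpret p: pair_sigma_finite "gauss_vec (T s \<omega>) :: (real ^ 'd) measure" M ..
    have "(\<integral>\<^sup>+ \<omega>'. G (T s \<omega> + T t \<omega>') \<partial>M)
        = (\<integral>\<^sup>+ \<omega>'. \<integral>\<^sup>+ y. \<integral>\<^sup>+ z. f (y + z) \<partial>gauss_vec (T t \<omega>') \<partial>gauss_vec (T s \<omega>) \<partial>M)"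
      using Tpos \<omega> st by (intro nn_integral_cong) (simp add: G nn_integral_gauss_vec_add[OF W])
    also have "\<dots> = (\<integral>\<^sup>+ \<omega>'. \<integral>\<^sup>+ y. \<integral>\<^sup>+ z. ennreal (gauss_dens (T t \<omega>') z) * f (y + z) \<partial>lborel \<partial>gauss_vec (T s \<omega>) \<partial>M)"
      by (intro nn_integral_cong) (simp add: nn_integral_gauss_vec)
    also have "\<dots> = (\<integral>\<^sup>+ y. \<integral>\<^sup>+ \<omega>'. \<integral>\<^sup>+ z. ennreal (gauss_dens (T t \<omega>') z) * f (y + z) \<partial>lborel \<partial>M \<partial>gauss_vec (T s \<omega>))"
      by (rule p.Fubini') measurable
    also have "\<dots> = (\<integral>\<^sup>+ y. \<integral>\<^sup>+ z. f (y + z) \<partial>subord_law M T t \<partial>gauss_vec (T s \<omega>))"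
      by (intro nn_integral_cong) (simp add: nn_integral_subord_law[OF T] nn_integral_gauss_vec)
    finally show "(\<integral>\<^sup>+ \<omega>'. G (T s \<omega> + T t \<omega>') \<partial>M)
        = (\<integral>\<^sup>+ y. \<integral>\<^sup>+ z. f (y + z) \<partial>subord_law M T t \<partial>gauss_vec (T s \<omega>))" .
  qed
  also have "\<dots> = (\<integral>\<^sup>+ y. \<integral>\<^sup>+ z. f (y + z) \<partial>subord_law M T t \<partial>subord_law M T s)"
  proof -
    interpret L: sigma_finite_measure "lborel :: (real ^ 'd) measure" ..
    \<comment> \<open>Writing the inner integral with the density exposes its measurability in
      \<open>y\<close>, which \<open>nn_integral_subord_law\<close> requires.\<close>
    have "(\<lambda>y. \<integral>\<^sup>+ z. (\<integral>\<^sup>+ \<omega>. ennreal (gauss_dens (T t \<omega>) z) \<partial>M) * f (y + z) \<partial>lborel) \<in> borel_measurable borel"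
      by measurable
    then have "(\<lambda>y. \<integral>\<^sup>+ z. f (y + z) \<partial>subord_law M T t) \<in> borel_measurable borel"
      unfolding subord_law_def by (simp add: nn_integral_density)
    from nn_integral_subord_law[OF T this] show ?thesis by simp
  qed
  finally show ?thesis .
qed

lemma prob_space_subord_law:
  assumes W: "wiener_process N (W :: real \<Rightarrow> 'a \<Rightarrow> real ^ 'd::finite)" and T: "subordinator M T" and "0 < t"
  shows "prob_space (subord_law M T t :: (real ^ 'd) measure)"
proof
  interpret prob_space M using T by (simp add: subordinator_def)
  have "emeasure (subord_law M T t :: (real ^ 'd) measure) UNIV
      = (\<integral>\<^sup>+ w. indicator UNIV w \<partial>(subord_law M T t :: (real ^ 'd) measure))"
    by (rule nn_integral_indicator[symmetric]) simp
  also have "\<dots> = (\<integral>\<^sup>+ \<omega>. \<integral>\<^sup>+ w. indicator UNIV w \<partial>(gauss_vec (T t \<omega>) :: (real ^ 'd) measure) \<partial>M)"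
    by (rule nn_integral_subord_law[OF T]) simp
  also have "\<dots> = (\<integral>\<^sup>+ \<omega>. 1 \<partial>M)"
  proof (intro nn_integral_cong)
    fix \<omega> assume "\<omega> \<in> space M"
    then have "0 < T t \<omega>" using T \<open>0 < t\<close> by (auto simp: subordinator_def)
    from prob_space.emeasure_space_1[OF prob_space_gauss_vec[OF W this]]
    show "(\<integral>\<^sup>+ w. indicator UNIV w \<partial>(gauss_vec (T t \<omega>) :: (real ^ 'd) measure)) = 1" by simp
  qed
  finally show "emeasure (subord_law M T t :: (real ^ 'd) measure) (space (subord_law M T t)) = 1"
    by (simp add: emeasure_space_1)
qed

text \<open>Adding the constant \<open>m\<close> makes \<open>f\<close> nonnegative and reduces the
  claim to \<open>nn_integral_subord_law\<close>. All measures involved are probabilities, so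
  \<open>m\<close> cancels afterwards.\<close>

lemma integral_subord_law:
  fixes f :: "real ^ 'd::finite \<Rightarrow> real"
  assumes W: "wiener_process N (W :: real \<Rightarrow> 'a \<Rightarrow> real ^ 'd)" and T: "subordinator M T" and "0 < t"
    and [measurable]: "f \<in> borel_measurable borel" and bd: "\<And>w. \<bar>f w\<bar> \<le> m"
  shows "integrable M (\<lambda>\<omega>. \<integral> w. f w \<partial>gauss_vec (T t \<omega>))"
    and "(\<integral> w. f w \<partial>subord_law M T t) = (\<integral> \<omega>. \<integral> w. f w \<partial>gauss_vec (T t \<omega>) \<partial>M)"
proof -
  interpret prob_space M using T by (simp add: subordinator_def)
  interpret \<nu>: prob_space "subord_law M T t :: (real ^ 'd) measure"
    by (rule prob_space_subord_law[OF W T \<open>0 < t\<close>])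
  have Tm [measurable]: "T t \<in> borel_measurable M" for t using T by (auto simp: subordinator_def)
  have Tpos: "0 < T t \<omega>" if "\<omega> \<in> space M" for \<omega>
    using T \<open>0 < t\<close> that by (auto simp: subordinator_def)
  have ps: "prob_space (gauss_vec (T t \<omega>) :: (real ^ 'd) measure)" if "\<omega> \<in> space M" for \<omega>
    by (rule prob_space_gauss_vec[OF W Tpos[OF that]])
  have fi: "integrable K f" if "prob_space K" "sets K = sets borel" for K
  proof -
    interpret K: prob_space K by fact
    show ?thesis using that(2) bd by (intro K.integrable_const_bound[of _ m]) (auto cong: measurable_cong_sets)
  qed
  define I where "I \<omega> = (\<integral> w. f w \<partial>gauss_vec (T t \<omega>))" for \<omega>
  have "I \<omega> = (\<integral> z. gauss_dens (T t \<omega>) z * f z \<partial>lborel)" for \<omega>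
    using integral_gauss_vec_shift[where f = f and x = 0 and r = "T t \<omega>"] by (simp add: I_def)
  then have Im [measurable]: "I \<in> borel_measurable M"
    by (subst measurable_cong) (assumption, measurable)
  have Ib: "\<bar>I \<omega>\<bar> \<le> m" if "\<omega> \<in> space M" for \<omega>
  proof -
    interpret K: prob_space "gauss_vec (T t \<omega>) :: (real ^ 'd) measure" by (rule ps[OF that])
    have "norm (I \<omega>) \<le> (\<integral> w. m \<partial>(gauss_vec (T t \<omega>) :: (real ^ 'd) measure))"
      unfolding I_def by (rule Bochner_Integration.integral_norm_bound_integral) (auto intro!: fi K.prob_space_axioms simp: bd)
    then show ?thesis using K.prob_space by simp
  qed
  have Ii: "integrable M I"
    using Ib by (intro integrable_const_bound[of _ m]) auto
  then show "integrable M (\<lambda>\<omega>. \<integral> w. f w \<partial>gauss_vec (T t \<omega>))" by (simp add: I_def[abs_def])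
  have nn: "0 \<le> f w + m" for w using bd[of w] by linarith
  have pos: "0 \<le> I \<omega> + m" if "\<omega> \<in> space M" for \<omega> using Ib[OF that] by linarith
  have shift: "(\<integral> w. f w + m \<partial>K) = (\<integral> w. f w \<partial>K) + m" if "prob_space K" "sets K = sets borel" for K
  proof -
    interpret K: prob_space K by fact
    show ?thesis using fi[OF that] by (simp add: K.prob_space)
  qed
  have enn: "(\<integral>\<^sup>+ w. ennreal (f w + m) \<partial>K) = ennreal ((\<integral> w. f w \<partial>K) + m)" if K: "prob_space K" "sets K = sets borel" for K
  proof -
    interpret K: prob_space K by fact
    show ?thesis using fi[OF K] nn by (subst nn_integral_eq_integral) (auto simp: shift[OF K])
  qed
  have "ennreal ((\<integral> w. f w \<partial>subord_law M T t) + m) = (\<integral>\<^sup>+ w. ennreal (f w + m) \<partial>subord_law M T t)"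
    by (simp add: enn \<nu>.prob_space_axioms)
  also have "\<dots> = (\<integral>\<^sup>+ \<omega>. \<integral>\<^sup>+ w. ennreal (f w + m) \<partial>gauss_vec (T t \<omega>) \<partial>M)"
    by (rule nn_integral_subord_law[OF T]) simp
  also have "\<dots> = (\<integral>\<^sup>+ \<omega>. ennreal (I \<omega> + m) \<partial>M)"
    by (intro nn_integral_cong) (simp add: enn ps I_def)
  also have "\<dots> = ennreal ((\<integral> \<omega>. I \<omega> \<partial>M) + m)"
    using Ii pos by (subst nn_integral_eq_integral) (auto simp: prob_space)
  finally have "(\<integral> w. f w \<partial>subord_law M T t) + m = (\<integral> \<omega>. I \<omega> \<partial>M) + m"
  proof (subst (asm) ennreal_inj)
    have "0 \<le> (\<integral> w. f w + m \<partial>subord_law M T t)" using nn by (intro integral_nonneg_AE) auto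
    then show "0 \<le> (\<integral> w. f w \<partial>subord_law M T t) + m" by (simp add: shift \<nu>.prob_space_axioms)
    have "0 \<le> (\<integral> \<omega>. I \<omega> + m \<partial>M)" using pos by (intro integral_nonneg_AE) auto
    then show "0 \<le> (\<integral> \<omega>. I \<omega> \<partial>M) + m" using Ii by (simp add: prob_space)
  qed
  then show "(\<integral> w. f w \<partial>subord_law M T t) = (\<integral> \<omega>. \<integral> w. f w \<partial>gauss_vec (T t \<omega>) \<partial>M)"
    by (simp add: I_def)
qed

section \<open>Total variation and integration lemmas\<close>

lemma (in prob_space) abs_integral_diff_le:
  fixes f g :: "'a \<Rightarrow> real"
  assumes "integrable M f" "integrable M g" "AE x in M. \<bar>f x - g x\<bar> \<le> K"
  shows "\<bar>(\<integral> x. f x \<partial>M) - (\<integral> x. g x \<partial>M)\<bar> \<le> K"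
proof -
  have "\<bar>(\<integral> x. f x \<partial>M) - (\<integral> x. g x \<partial>M)\<bar> = \<bar>\<integral> x. f x - g x \<partial>M\<bar>"
    using assms by simp
  also have "\<dots> \<le> (\<integral> x. \<bar>f x - g x\<bar> \<partial>M)"
    using integral_norm_bound[of M "\<lambda>x. f x - g x"] by simp
  also have "\<dots> \<le> K"
    using assms by (intro integral_le_const) auto
  finally show ?thesis .
qed

lemma (in prob_space) integrable_bounded_comp:
  fixes f :: "'b \<Rightarrow> real"
  assumes "\<And>x. \<bar>f x\<bar> \<le> m" "f \<in> borel_measurable N" "g \<in> measurable M N"
  shows "integrable M (\<lambda>x. f (g x))"
  using assms by (intro integrable_const_bound[of _ m]) auto

lemma continuous_on_uniform_approx:
  fixes f :: "'a::topological_space \<Rightarrow> real"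
  assumes "\<And>e. 0 < e \<Longrightarrow> \<exists>g. continuous_on S g \<and> (\<forall>x\<in>S. \<bar>f x - g x\<bar> \<le> e)"
  shows "continuous_on S f"
proof -
  have "\<forall>n. \<exists>g. continuous_on S g \<and> (\<forall>x\<in>S. \<bar>f x - g x\<bar> \<le> inverse (real (Suc n)))"
    by (intro allI assms) simp
  then obtain g where g: "\<And>n. continuous_on S (g n)"
      "\<And>n x. x \<in> S \<Longrightarrow> \<bar>f x - g n x\<bar> \<le> inverse (real (Suc n))" by metis
  have "uniform_limit S g f sequentially"
  proof (rule uniform_limitI)
    fix e :: real assume "0 < e"
    then have "\<forall>\<^sub>F n in sequentially. inverse (real (Suc n)) < e"
      using order_tendstoD(2)[OF LIMSEQ_inverse_real_of_nat] by simp
    then show "\<forall>\<^sub>F n in sequentially. \<forall>x\<in>S. dist (g n x) (f x) < e"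
    proof eventually_elim
      case (elim n)
      show ?case
      proof
        fix x assume "x \<in> S"
        from g(2)[OF this, of n] elim show "dist (g n x) (f x) < e" by (simp add: dist_real_def abs_minus_commute)
      qed
    qed
  qed
  then show ?thesis
    by (rule uniform_limit_theorem[rotated]) (auto intro: g always_eventually)
qed

text \<open>The indicator of an open set is a pointwise limit of the Lipschitz functions
  \<open>f n\<close> below. Their Lipschitz constants grow, but \<open>K\<close> does not depend on
  \<open>L\<close>, so the bound survives the limit. Outer regularity of \<nu> then carries it from
  open sets to Borel sets.\<close>

lemma lipschitz_test_imp_measure_diff_le:
  fixes \<mu> \<nu> :: "'a::polish_space measure"
  assumes "prob_space \<mu>" "prob_space \<nu>" and sets: "sets \<mu> = sets borel" "sets \<nu> = sets borel"
    and test: "\<And>f L. (\<And>x. 0 \<le> f x \<and> f x \<le> (1::real)) \<Longrightarrow> 0 \<le> L \<Longrightarrow> (\<And>x y. \<bar>f x - f y\<bar> \<le> L * dist x y)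
       \<Longrightarrow> (\<integral> x. f x \<partial>\<mu>) \<le> (\<integral> x. f x \<partial>\<nu>) + K"
    and A: "A \<in> sets borel"
  shows "measure \<mu> A \<le> measure \<nu> A + K"
proof -
  interpret \<mu>: prob_space \<mu> by fact
  interpret \<nu>: prob_space \<nu> by fact
  note [measurable_cong] = sets
  have opn: "measure \<mu> U \<le> measure \<nu> U + K" if "open U" for U
  proof (cases "U = UNIV")
    \<comment> \<open>The whole space is separate: \<open>infdist\<close> to the empty set is 0 by
      convention, so the approximants used below would vanish. Testing with the zero function gives
      \<open>0 \<le> K\<close>.\<close>
    case True
    have "measure \<mu> UNIV = 1" "measure \<nu> UNIV = 1"
      using \<mu>.prob_space \<nu>.prob_space sets_eq_imp_space_eq[OF sets(1)] sets_eq_imp_space_eq[OF sets(2)] by auto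
    with test[of "\<lambda>_. 0" 0] True show ?thesis by simp
  next
    case False
    then have ne: "- U \<noteq> {}" by auto
    have cl: "closed (- U)" using that by (simp add: closed_Compl)
    have [measurable]: "U \<in> sets borel" using that by simp
    define f where "f n x = min 1 (real n * infdist x (- U))" for n x
    have f01: "0 \<le> f n x \<and> f n x \<le> 1" for n x
      by (auto simp: f_def infdist_nonneg)
    have lip: "\<bar>f n x - f n y\<bar> \<le> real n * dist x y" for n x y
    proof -
      have "\<bar>f n x - f n y\<bar> \<le> \<bar>real n * infdist x (- U) - real n * infdist y (- U)\<bar>"
        by (auto simp: f_def min_def)
      also have "\<dots> = real n * \<bar>infdist x (- U) - infdist y (- U)\<bar>"
        by (simp add: right_diff_distrib[symmetric] abs_mult)
      also have "\<dots> \<le> real n * dist x y"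
        by (intro mult_left_mono infdist_triangle_abs) simp
      finally show ?thesis .
    qed
    have [measurable]: "f n \<in> borel_measurable borel" for n
      unfolding f_def by (intro borel_measurable_continuous_onI continuous_intros)
    have lim: "(\<lambda>n. f n x) \<longlonglongrightarrow> indicator U x" for x
    proof (cases "x \<in> U")
      case True
      then have pos: "0 < infdist x (- U)"
        using infdist_pos_not_in_closed[OF cl ne] by auto
      obtain k where k: "1 / infdist x (- U) \<le> real k" using real_arch_simple by blast
      have "f n x = 1" if "k \<le> n" for n
      proof -
        have "1 / infdist x (- U) \<le> real n" using k that by (meson of_nat_mono order_trans)
        then show ?thesis using pos by (simp add: f_def pos_divide_le_eq)
      qed
      then have "\<forall>\<^sub>F n in sequentially. f n x = indicator U x"
        using True by (auto simp: eventually_sequentially)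
      then show ?thesis by (rule tendsto_eventually)
    next
      case False
      then show ?thesis by (simp add: f_def)
    qed
    have dc: "(\<lambda>n. \<integral> x. f n x \<partial>\<rho>) \<longlonglongrightarrow> measure \<rho> U" if "prob_space \<rho>" and [measurable_cong]: "sets \<rho> = sets borel" for \<rho>
    proof -
      interpret \<rho>: prob_space \<rho> by fact
      have "(\<lambda>n. \<integral> x. f n x \<partial>\<rho>) \<longlonglongrightarrow> (\<integral> x. indicator U x \<partial>\<rho>)"
        by (rule integral_dominated_convergence[where w = "\<lambda>_. 1"]) (use lim f01 in auto)
      then show ?thesis by simp
    qed
    show ?thesis
      using dc[OF \<open>prob_space \<mu>\<close> sets(1)] tendsto_add[OF dc[OF \<open>prob_space \<nu>\<close> sets(2)] tendsto_const[of K]]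
      by (rule LIMSEQ_le) (use test[OF f01 _ lip] in auto)
  qed
  show ?thesis
  proof (rule field_le_epsilon)
    fix e :: real assume "0 < e"
    have "\<exists>U. A \<subseteq> U \<and> open U \<and> emeasure \<nu> U < emeasure \<nu> A + ennreal e"
    proof -
      have eq: "(INF U \<in> {U. A \<subseteq> U \<and> open U}. emeasure \<nu> U) = emeasure \<nu> A"
        by (rule outer_regular[OF sets(2) _ A, symmetric]) simp
      have "(INF U \<in> {U. A \<subseteq> U \<and> open U}. emeasure \<nu> U) < emeasure \<nu> A + ennreal e"
        unfolding eq using \<open>0 < e\<close> by (simp add: \<nu>.emeasure_eq_measure ennreal_less_iff flip: ennreal_plus)
      then show ?thesis by (auto simp: Inf_less_iff)
    qed
    then obtain U where U: "A \<subseteq> U" "open U" "emeasure \<nu> U < emeasure \<nu> A + ennreal e" by auto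
    have "measure \<nu> U \<le> measure \<nu> A + e"
      using U(3) \<open>0 < e\<close> by (simp add: \<nu>.emeasure_eq_measure ennreal_less_iff flip: ennreal_plus)
    moreover have "measure \<mu> A \<le> measure \<mu> U"
      using U A sets by (intro \<mu>.finite_measure_mono) auto
    ultimately show "measure \<mu> A \<le> measure \<nu> A + K + e" using opn[OF U(2)] by linarith
  qed
qed

lemma nn_integral_layer_cake:
  assumes "sigma_finite_measure \<mu>" and [measurable]: "f \<in> borel_measurable \<mu>" and f: "\<And>x. 0 \<le> f x \<and> f x \<le> (1::real)"
  shows "(\<integral>\<^sup>+ x. ennreal (f x) \<partial>\<mu>) = (\<integral>\<^sup>+ s. indicator {0..<1} s * emeasure \<mu> {x \<in> space \<mu>. s < f x} \<partial>lborel)"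
proof -
  interpret \<mu>: sigma_finite_measure \<mu> by fact
  interpret pair_sigma_finite \<mu> "lborel :: real measure" ..
  have "(\<integral>\<^sup>+ x. ennreal (f x) \<partial>\<mu>) = (\<integral>\<^sup>+ x. \<integral>\<^sup>+ s. indicator {0..<1} s * indicator {s. s < f x} s \<partial>lborel \<partial>\<mu>)"
  proof (intro nn_integral_cong)
    fix x
    have "(\<integral>\<^sup>+ s. indicator {0..<1} s * indicator {s. s < f x} s \<partial>lborel) = (\<integral>\<^sup>+ s. indicator {0..<f x} s \<partial>lborel)"
      using f[of x] by (intro nn_integral_cong) (auto split: split_indicator)
    then show "ennreal (f x) = (\<integral>\<^sup>+ s. indicator {0..<1} s * indicator {s. s < f x} s \<partial>lborel)"
      using f[of x] by simp
  qed
  also have "\<dots> = (\<integral>\<^sup>+ s. \<integral>\<^sup>+ x. indicator {0..<1} s * indicator {s. s < f x} s \<partial>\<mu> \<partial>lborel)"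
    by (rule Fubini'[symmetric]) measurable
  also have "\<dots> = (\<integral>\<^sup>+ s. indicator {0..<1} s * (\<integral>\<^sup>+ x. indicator {x \<in> space \<mu>. s < f x} x \<partial>\<mu>) \<partial>lborel)"
  proof (intro nn_integral_cong)
    fix s :: real
    have "(\<integral>\<^sup>+ x. indicator {0..<1} s * indicator {s. s < f x} s \<partial>\<mu>)
        = (\<integral>\<^sup>+ x. indicator {0..<1} s * indicator {x \<in> space \<mu>. s < f x} x \<partial>\<mu>)"
      by (intro nn_integral_cong) (auto split: split_indicator)
    also have "\<dots> = indicator {0..<1} s * (\<integral>\<^sup>+ x. indicator {x \<in> space \<mu>. s < f x} x \<partial>\<mu>)"
      by (rule nn_integral_cmult) measurable
    finally show "(\<integral>\<^sup>+ x. indicator {0..<1} s * indicator {s. s < f x} s \<partial>\<mu>)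
        = indicator {0..<1} s * (\<integral>\<^sup>+ x. indicator {x \<in> space \<mu>. s < f x} x \<partial>\<mu>)" .
  qed
  finally show ?thesis by simp
qed

text \<open>A function with values in \<open>[0, 1]\<close> is the average, over levels
  \<open>s\<close> in \<open>[0, 1)\<close>, of the indicators of its superlevel sets. The bound on
  sets therefore passes to it with the same \<open>K\<close>.\<close>

lemma integral_diff_le_of_measure_diff_le:
  assumes "prob_space \<mu>" "prob_space \<nu>" and sets: "sets \<mu> = sets borel" "sets \<nu> = sets borel"
    and K: "\<And>A. A \<in> sets borel \<Longrightarrow> measure \<mu> A \<le> measure \<nu> A + K" "0 \<le> K"
    and [measurable]: "f \<in> borel_measurable borel" and f: "\<And>x. 0 \<le> f x \<and> f x \<le> (1::real)"
  shows "(\<integral> x. f x \<partial>\<mu>) \<le> (\<integral> x. f x \<partial>\<nu>) + K"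
proof -
  interpret \<mu>: prob_space \<mu> by fact
  interpret \<nu>: prob_space \<nu> by fact
  note [measurable_cong] = sets
  have sp: "space \<mu> = UNIV" "space \<nu> = UNIV"
    using sets_eq_imp_space_eq[OF sets(1)] sets_eq_imp_space_eq[OF sets(2)] by auto
  have int: "integrable \<mu> f" "integrable \<nu> f"
    using f by (auto intro!: \<mu>.integrable_const_bound[of _ 1] \<nu>.integrable_const_bound[of _ 1])
  have mm: "(\<lambda>s. emeasure \<nu> {x. s < f x}) \<in> borel_measurable borel"
  proof -
    have "(\<lambda>s. \<integral>\<^sup>+ x. indicator {x. s < f x} x \<partial>\<nu>) \<in> borel_measurable borel"
      by measurable
    then show ?thesis by simp
  qed
  have "ennreal (\<integral> x. f x \<partial>\<mu>) = (\<integral>\<^sup>+ x. ennreal (f x) \<partial>\<mu>)"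
    using f int by (subst nn_integral_eq_integral) auto
  also have "\<dots> = (\<integral>\<^sup>+ s. indicator {0..<1} s * emeasure \<mu> {x. s < f x} \<partial>lborel)"
    using f by (subst nn_integral_layer_cake) (auto simp: sp \<mu>.sigma_finite_measure_axioms)
  also have "\<dots> \<le> (\<integral>\<^sup>+ s. indicator {0..<1} s * emeasure \<nu> {x. s < f x} + ennreal K * indicator {0..<1} s \<partial>lborel)"
  proof (intro nn_integral_mono)
    fix s :: real
    have "measure \<mu> {x. s < f x} \<le> measure \<nu> {x. s < f x} + K" by (rule K) measurable
    then have "emeasure \<mu> {x. s < f x} \<le> emeasure \<nu> {x. s < f x} + ennreal K"
      using \<open>0 \<le> K\<close> by (simp add: \<mu>.emeasure_eq_measure \<nu>.emeasure_eq_measure ennreal_leI flip: ennreal_plus)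
    then show "indicator {0..<1} s * emeasure \<mu> {x. s < f x} \<le> indicator {0..<1} s * emeasure \<nu> {x. s < f x} + ennreal K * indicator {0..<1} s"
      by (auto split: split_indicator)
  qed
  also have "\<dots> = (\<integral>\<^sup>+ s. indicator {0..<1} s * emeasure \<nu> {x. s < f x} \<partial>lborel) + ennreal K"
    using mm by (subst nn_integral_add) (auto simp: nn_integral_cmult)
  also have "\<dots> = (\<integral>\<^sup>+ x. ennreal (f x) \<partial>\<nu>) + ennreal K"
    using f by (subst nn_integral_layer_cake) (auto simp: sp \<nu>.sigma_finite_measure_axioms)
  also have "\<dots> = ennreal (\<integral> x. f x \<partial>\<nu>) + ennreal K"
    using f int by (subst nn_integral_eq_integral) auto
  also have "\<dots> = ennreal ((\<integral> x. f x \<partial>\<nu>) + K)"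
    using \<open>0 \<le> K\<close> f by (intro ennreal_plus[symmetric] integral_nonneg_AE) auto
  finally show ?thesis
    using \<open>0 \<le> K\<close> f by (subst (asm) ennreal_le_iff) (auto intro!: add_nonneg_nonneg integral_nonneg_AE)
qed

text \<open>Because \<open>K\<close> is the same for all Lipschitz constants, Lipschitz tests
  already control the total variation. The map \<open>g\<close> rescales \<open>f\<close> to
  \<open>[0, 1]\<close>, and \<open>2 * m\<close> is the length of the interval from
  \<open>- m\<close> to \<open>m\<close>.\<close>

lemma lipschitz_test_imp_bounded_test:
  fixes \<mu> \<nu> :: "'a::polish_space measure"
  assumes \<mu>\<nu>: "prob_space \<mu>" "prob_space \<nu>" "sets \<mu> = sets borel" "sets \<nu> = sets borel"
    and test: "\<And>f L. (\<And>x. 0 \<le> f x \<and> f x \<le> (1::real)) \<Longrightarrow> 0 \<le> L \<Longrightarrow> (\<And>x y. \<bar>f x - f y\<bar> \<le> L * dist x y)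
       \<Longrightarrow> \<bar>(\<integral> x. f x \<partial>\<mu>) - (\<integral> x. f x \<partial>\<nu>)\<bar> \<le> K"
    and f [measurable]: "f \<in> borel_measurable borel" and bd: "\<And>x. \<bar>f x\<bar> \<le> m" and "0 < m"
  shows "\<bar>(\<integral> x. f x \<partial>\<mu>) - (\<integral> x. f x \<partial>\<nu>)\<bar> \<le> 2 * m * K"
proof -
  interpret \<mu>: prob_space \<mu> by fact
  interpret \<nu>: prob_space \<nu> by fact
  note [measurable_cong] = \<mu>\<nu>(3,4)
  have K: "0 \<le> K" using test[of "\<lambda>_. 0" 0] by simp
  define g where "g x = (f x + m) / (2 * m)" for x
  have g01: "0 \<le> g x \<and> g x \<le> 1" for x
    using bd[of x] \<open>0 < m\<close> by (auto simp: g_def field_simps)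
  have [measurable]: "g \<in> borel_measurable borel" unfolding g_def by measurable
  have fg: "f x = 2 * m * g x - m" for x using \<open>0 < m\<close> by (simp add: g_def)
  have "measure \<mu> A \<le> measure \<nu> A + K" if "A \<in> sets borel" for A
  proof (rule lipschitz_test_imp_measure_diff_le[OF \<mu>\<nu> _ that])
    fix f :: "'a \<Rightarrow> real" and L
    assume "\<And>x. 0 \<le> f x \<and> f x \<le> 1" "0 \<le> L" "\<And>x y. \<bar>f x - f y\<bar> \<le> L * dist x y"
    from test[OF this] show "(\<integral> x. f x \<partial>\<mu>) \<le> (\<integral> x. f x \<partial>\<nu>) + K" by linarith
  qed
  then have 1: "(\<integral> x. g x \<partial>\<mu>) \<le> (\<integral> x. g x \<partial>\<nu>) + K"
    using K g01 by (intro integral_diff_le_of_measure_diff_le[OF \<mu>\<nu>]) auto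
  have "measure \<nu> A \<le> measure \<mu> A + K" if "A \<in> sets borel" for A
  proof (rule lipschitz_test_imp_measure_diff_le[OF \<mu>\<nu>(2,1,4,3) _ that])
    fix f :: "'a \<Rightarrow> real" and L
    assume "\<And>x. 0 \<le> f x \<and> f x \<le> 1" "0 \<le> L" "\<And>x y. \<bar>f x - f y\<bar> \<le> L * dist x y"
    from test[OF this] show "(\<integral> x. f x \<partial>\<nu>) \<le> (\<integral> x. f x \<partial>\<mu>) + K" by linarith
  qed
  then have 2: "(\<integral> x. g x \<partial>\<nu>) \<le> (\<integral> x. g x \<partial>\<mu>) + K"
    using K g01 by (intro integral_diff_le_of_measure_diff_le[OF \<mu>\<nu>(2,1,4,3)]) auto
  have "integrable \<mu> g" "integrable \<nu> g"
    using g01 by (auto intro!: \<mu>.integrable_const_bound[of _ 1] \<nu>.integrable_const_bound[of _ 1])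
  then have "(\<integral> x. f x \<partial>\<mu>) - (\<integral> x. f x \<partial>\<nu>) = 2 * m * ((\<integral> x. g x \<partial>\<mu>) - (\<integral> x. g x \<partial>\<nu>))"
    unfolding fg by (simp add: \<mu>.prob_space \<nu>.prob_space right_diff_distrib)
  then have "\<bar>(\<integral> x. f x \<partial>\<mu>) - (\<integral> x. f x \<partial>\<nu>)\<bar> = 2 * m * \<bar>(\<integral> x. g x \<partial>\<mu>) - (\<integral> x. g x \<partial>\<nu>)\<bar>"
    using \<open>0 < m\<close> by (simp add: abs_mult)
  also have "\<dots> \<le> 2 * m * K"
    using 1 2 \<open>0 < m\<close> by (intro mult_left_mono) (auto simp: abs_le_iff)
  finally show ?thesis .
qed

text \<open>On \<open>{s - h<..s}\<close> the decreasing function is at least its value at the right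
  end. Summed over the steps, this keeps a right-endpoint Riemann sum below the integral even if
  \<phi> is singular at 0.\<close>

lemma antimono_set_integral_step:
  fixes \<phi> :: "real \<Rightarrow> real"
  assumes int: "set_integrable lborel {0<..\<delta>} \<phi>"
    and anti: "\<And>s t. 0 < s \<Longrightarrow> s \<le> t \<Longrightarrow> \<phi> t \<le> \<phi> s"
    and h: "0 < h" "h \<le> s" "s \<le> \<delta>"
  shows "(LINT u:{0<..s - h}|lborel. \<phi> u) + h * \<phi> s \<le> (LINT u:{0<..s}|lborel. \<phi> u)"
proof -
  have sub: "set_integrable lborel S \<phi>" if "S \<in> sets borel" "S \<subseteq> {0<..\<delta>}" for S
    using set_integrable_subset[OF int] that by simp
  have eq: "{0<..s} = {0<..s - h} \<union> {s - h<..s}" using h by auto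
  have "h * \<phi> s = (LINT u:{s - h<..s}|lborel. \<phi> s)"
    using h by (simp add: set_lebesgue_integral_def)
  also have "\<dots> \<le> (LINT u:{s - h<..s}|lborel. \<phi> u)"
    using h by (intro set_integral_mono sub anti) (auto simp: set_integrable_def)
  finally show ?thesis
    unfolding eq using h by (subst set_integral_Un) (auto intro!: sub)
qed

lemma set_integral_initial_tendsto_0:
  fixes \<phi> :: "real \<Rightarrow> real"
  assumes int: "set_integrable lborel {0<..\<delta>} \<phi>" and "0 \<le> \<delta>" "0 \<le> t" "t \<le> \<delta>"
  shows "(\<lambda>n. LINT u:{0<..t / real (Suc n)}|lborel. \<phi> u) \<longlonglongrightarrow> 0"
proof -
  have "(\<lambda>n. LINT u|lborel. indicator {0<..t / real (Suc n)} u *\<^sub>R \<phi> u) \<longlonglongrightarrow> (LINT u|(lborel :: real measure). 0)"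
  proof (rule integral_dominated_convergence[where w = "\<lambda>u. \<bar>indicator {0<..\<delta>} u *\<^sub>R \<phi> u\<bar>"])
    have le: "t / real (Suc n) \<le> \<delta>" for n
    proof -
      have "t / real (Suc n) \<le> t / 1" using \<open>0 \<le> t\<close> by (intro divide_left_mono) auto
      then show ?thesis using \<open>t \<le> \<delta>\<close> by simp
    qed
    have "set_integrable lborel {0<..t / real (Suc n)} \<phi>" for n
      using le[of n] by (intro set_integrable_subset[OF int]) auto
    then show "(\<lambda>u. indicator {0<..t / real (Suc n)} u *\<^sub>R \<phi> u) \<in> borel_measurable lborel" for n
      by (auto simp: set_integrable_def)
    show "integrable lborel (\<lambda>u. \<bar>indicator {0<..\<delta>} u *\<^sub>R \<phi> u\<bar>)"
      using int by (auto simp: set_integrable_def)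
    show "AE u in lborel. norm (indicator {0<..t / real (Suc n)} u *\<^sub>R \<phi> u) \<le> \<bar>indicator {0<..\<delta>} u *\<^sub>R \<phi> u\<bar>" for n
      using le[of n] by (intro always_eventually) (auto split: split_indicator)
    show "AE u in lborel. (\<lambda>n. indicator {0<..t / real (Suc n)} u *\<^sub>R \<phi> u) \<longlonglongrightarrow> 0"
    proof (intro always_eventually allI)
      fix u :: real
      show "(\<lambda>n. indicator {0<..t / real (Suc n)} u *\<^sub>R \<phi> u) \<longlonglongrightarrow> 0"
      proof (cases "0 < u")
        case True
        have "(\<lambda>n. t * inverse (real (Suc n))) \<longlonglongrightarrow> t * 0"
          by (intro tendsto_mult tendsto_const LIMSEQ_inverse_real_of_nat)
        then have "\<forall>\<^sub>F n in sequentially. t * inverse (real (Suc n)) < u"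
          using True by (intro order_tendstoD(2)) auto
        then have "\<forall>\<^sub>F n in sequentially. indicator {0<..t / real (Suc n)} u *\<^sub>R \<phi> u = 0"
          by eventually_elim (auto simp: divide_inverse split: split_indicator)
        then show ?thesis by (rule tendsto_eventually)
      qed simp
    qed
  qed simp
  then show ?thesis by (simp add: set_lebesgue_integral_def)
qed

section \<open>Comparison of the two semigroups\<close>

text \<open>For \<open>r \<ge> 1\<close> the left side is at most 1, and for \<open>r < 1\<close>
  the more negative exponent dominates. This collects all singularities in time into the single
  power \<open>- 1/2 - \<kappa>\<close>.\<close>

lemma powr_le_one_plus_powr:
  fixes r :: real
  assumes "0 < r" "c \<le> a" "a \<le> 0"
  shows "r powr a \<le> 1 + r powr c"
proof (cases "1 \<le> r")
  case True
  then have "r powr a \<le> r powr 0" using assms by (intro powr_mono) auto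
  also have "\<dots> = 1" using assms by simp
  finally show ?thesis using powr_ge_zero[of r c] by linarith
next
  case False
  then have "r powr a \<le> r powr c" using assms by (intro powr_mono') auto
  then show ?thesis by linarith
qed

text \<open>The setting of the theorem with \<kappa> in place of
  \<open>d_over_p CARD('d) p / 2\<close> and an explicit bound \<open>B\<close> of the drift, so
  that finite and infinite \<open>p\<close> are treated alike. Each starting point has its own
  probability space; \<open>T0\<close> is the common reference for the laws of the
  subordinators.\<close>

locale subordinated_sde =
  fixes b :: "real ^ 'd::finite \<Rightarrow> real ^ 'd"
    and \<kappa> \<delta> B :: real
    and M0 :: "'b measure" and T0 :: "real \<Rightarrow> 'b \<Rightarrow> real"
    and M :: "real ^ 'd \<Rightarrow> 'a measure"
    and W :: "real ^ 'd \<Rightarrow> real \<Rightarrow> 'a \<Rightarrow> real ^ 'd"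
    and T :: "real ^ 'd \<Rightarrow> real \<Rightarrow> 'a \<Rightarrow> real"
    and X :: "real ^ 'd \<Rightarrow> real \<Rightarrow> 'a \<Rightarrow> real ^ 'd"
  assumes \<kappa>: "0 \<le> \<kappa>" and b_le: "\<And>z. norm (b z) \<le> B"
    and T0_sub: "subordinator M0 T0"
    and W_wiener: "\<And>x. wiener_process (M x) (W x)"
    and T_sub: "\<And>x. subordinator (M x) (T x)"
    and T_law: "\<And>x. same_fdd (M x) (T x) M0 T0"
    and WT_indep: "\<And>x. prob_space.indep_set (M x)
          (proc_sigma (M x) (W x)) (proc_sigma (M x) (T x))"
    and X_meas: "\<And>x t. X x t \<in> borel_measurable (M x)"
    and X_sol: "\<And>x. AE \<omega> in M x. \<forall>t\<ge>0.
          (\<lambda>s. b (X x s \<omega>)) integrable_on {0..t} \<and>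
          X x t \<omega> = x + integral {0..t} (\<lambda>s. b (X x s \<omega>)) + W x (T x t \<omega>) \<omega>"
    and X_markov: "\<And>x s t f. 0 \<le> s \<Longrightarrow> 0 \<le> t \<Longrightarrow> f \<in> borel_measurable borel \<Longrightarrow>
          bounded (range f) \<Longrightarrow>
          AE \<omega> in M x. real_cond_exp (M x) (nat_filtration (M x) (X x) s) (\<lambda>\<omega>. f (X x (s + t) \<omega>)) \<omega>
                         = trans_sg M X t f (X x s \<omega>)"
    and feller: "\<And>t f. 0 \<le> t \<Longrightarrow> continuous_on UNIV f \<Longrightarrow> bounded (range f) \<Longrightarrow>
          continuous_on UNIV (trans_sg M X t f)"
    and delta: "\<delta> > 0"
    and integ: "(\<integral>\<^sup>+ s. indicator {0<..\<delta>} s *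
          (\<integral>\<^sup>+ \<omega>. ennreal (T0 s \<omega> powr (- 1/2 - \<kappa>)) \<partial>M0) \<partial>lborel) < \<top>"
begin

section \<open>The noise semigroup and one step of the solution\<close>

sublocale M0: prob_space M0 using T0_sub by (simp add: subordinator_def)

sublocale M: prob_space "M x" for x using W_wiener[of x] by (simp add: wiener_process_def)

declare X_meas [measurable]

lemma B_nonneg: "0 \<le> B"
  using b_le[of 0] norm_ge_zero order_trans by blast

lemma T0_measurable [measurable]: "T0 t \<in> borel_measurable M0"
  using T0_sub by (simp add: subordinator_def)

lemma T0_pos: "\<omega> \<in> space M0 \<Longrightarrow> 0 < t \<Longrightarrow> 0 < T0 t \<omega>"
  using T0_sub by (simp add: subordinator_def)

lemma T0_mono: "\<omega> \<in> space M0 \<Longrightarrow> 0 \<le> s \<Longrightarrow> s \<le> t \<Longrightarrow> T0 s \<omega> \<le> T0 t \<omega>"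
  using T0_sub by (auto simp: subordinator_def mono_on_def)

abbreviation \<nu> :: "real \<Rightarrow> (real ^ 'd) measure" where "\<nu> t \<equiv> subord_law M0 T0 t"

definition Q :: "real \<Rightarrow> (real ^ 'd \<Rightarrow> real) \<Rightarrow> real ^ 'd \<Rightarrow> real" where
  "Q t f x = (\<integral> w. f (x + w) \<partial>\<nu> t)"

abbreviation P :: "real \<Rightarrow> (real ^ 'd \<Rightarrow> real) \<Rightarrow> real ^ 'd \<Rightarrow> real" where
  "P \<equiv> trans_sg M X"

lemma prob_space_\<nu>: "0 < t \<Longrightarrow> prob_space (\<nu> t)"
  by (rule prob_space_subord_law[OF W_wiener T0_sub])

lemma distr_subordinated: "0 < t \<Longrightarrow> distr (M x) borel (\<lambda>\<omega>. W x (T x t \<omega>) \<omega>) = \<nu> t"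
  by (simp add: distr_wiener_subordinated[OF W_wiener T_sub WT_indep] subord_law_cong[OF T_sub T0_sub T_law])

text \<open>Realises \<open>Q\<close> with the very noise that drives \<open>X x\<close>, on the
  same probability space. This coupling makes the pathwise comparison in \<open>one_step\<close>
  possible.\<close>

lemma Q_eq_expectation:
  assumes "0 < t" and [measurable]: "f \<in> borel_measurable borel"
  shows "Q t f x = (\<integral> \<omega>. f (x + W x (T x t \<omega>) \<omega>) \<partial>M x)"
  unfolding Q_def distr_subordinated[OF \<open>0 < t\<close>, of x, symmetric]
  using wiener_subordinated_measurable[OF W_wiener T_sub WT_indep \<open>0 < t\<close>, of x]
  by (subst integral_distr) auto

lemma P_integrable:
  fixes f :: "real ^ 'd \<Rightarrow> real"
  assumes "f \<in> borel_measurable borel" "\<And>x. \<bar>f x\<bar> \<le> m"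
  shows "integrable (M x) (\<lambda>\<omega>. f (X x t \<omega>))"
  by (rule M.integrable_bounded_comp[where f = f and m = m and N = borel]) (use assms in auto)

text \<open>With the same noise in both terms, the two positions at time \<open>h\<close> differ
  exactly by the drift integral, whose norm is at most \<open>B * h\<close>; the Lipschitz bound of
  \<open>g\<close> carries this to the expectations.\<close>

lemma one_step:
  assumes "0 < h" and [measurable]: "g \<in> borel_measurable borel" and bd: "\<And>x. \<bar>g x\<bar> \<le> m"
    and lip: "\<And>u v. \<bar>g u - g v\<bar> \<le> L * norm (u - v)" and "0 \<le> L"
  shows "\<bar>P h g x - Q h g x\<bar> \<le> h * B * L"
proof -
  note Wm [measurable] = wiener_subordinated_measurable[OF W_wiener T_sub WT_indep \<open>0 < h\<close>, of x]
  have "AE \<omega> in M x. \<bar>g (X x h \<omega>) - g (x + W x (T x h \<omega>) \<omega>)\<bar> \<le> h * B * L"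
    using X_sol[of x]
  proof eventually_elim
    case (elim \<omega>)
    let ?\<beta> = "integral {0..h} (\<lambda>s. b (X x s \<omega>))"
    have int: "(\<lambda>s. b (X x s \<omega>)) integrable_on {0..h}" and eq: "X x h \<omega> = x + ?\<beta> + W x (T x h \<omega>) \<omega>"
      using elim \<open>0 < h\<close> by auto
    from int have "((\<lambda>s. b (X x s \<omega>)) has_integral ?\<beta>) (cbox 0 h)"
      by (simp add: has_integral_integral)
    from has_integral_bound[OF B_nonneg this] have "norm ?\<beta> \<le> B * h"
      using b_le \<open>0 < h\<close> by simp
    moreover have "\<bar>g (X x h \<omega>) - g (x + W x (T x h \<omega>) \<omega>)\<bar> \<le> L * norm ?\<beta>"
      using lip[of "X x h \<omega>" "x + W x (T x h \<omega>) \<omega>"] by (simp add: eq)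
    ultimately show ?case
      using mult_left_mono[of "norm ?\<beta>" "B * h" L] \<open>0 \<le> L\<close> by (simp add: mult_ac)
  qed
  then show ?thesis
    unfolding trans_sg_def Q_eq_expectation[OF assms(1,2)] using bd
    by (intro M.abs_integral_diff_le M.integrable_bounded_comp[where N = borel and f = g and m = m]) auto
qed

text \<open>Stated with an approximation \<open>g\<close> because \<open>P t f\<close> is not known to be measurable
  before the strong Feller property is available.\<close>

lemma markov_approx:
  assumes "0 \<le> s" "0 \<le> t" and f [measurable]: "f \<in> borel_measurable borel" and fm: "\<And>x. \<bar>f x\<bar> \<le> m"
    and g [measurable]: "g \<in> borel_measurable borel" and gm: "\<And>x. \<bar>g x\<bar> \<le> m'"
    and le: "\<And>y. \<bar>P t f y - g y\<bar> \<le> K"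
  shows "\<bar>P (s + t) f x - P s g x\<bar> \<le> K"
proof -
  let ?F = "nat_filtration (M x) (X x) s"
  have gen: "{X x r -` A \<inter> space (M x) | r A. 0 \<le> r \<and> r \<le> s \<and> A \<in> sets borel} \<subseteq> sets (M x)"
    by auto
  have "subalgebra (M x) ?F"
    unfolding subalgebra_def nat_filtration_def
    using sets.sigma_sets_subset[OF gen] gen sets.space_closed[of "M x"]
    by (subst sets_measure_of) (auto intro: order_trans)
  then interpret finite_measure_subalgebra "M x" ?F
    by unfold_locales
  have int: "integrable (M x) (\<lambda>\<omega>. f (X x (s + t) \<omega>))" by (rule P_integrable[OF f fm])
  have "bounded (range f)" using fm by (auto simp: bounded_iff)
  \<comment> \<open>The conditional expectation replaces \<open>P t f (X x s \<omega>)\<close>: it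
    is measurable by construction, agrees with it almost surely and has the same integral as
    \<open>f (X x (s + t) \<omega>)\<close>. Since \<open>le\<close> holds at every point, it is
    within \<open>K\<close> of \<open>g (X x s \<omega>)\<close>.\<close>
  from X_markov[OF \<open>0 \<le> s\<close> \<open>0 \<le> t\<close> f this, of x]
  have "AE \<omega> in M x. \<bar>real_cond_exp (M x) ?F (\<lambda>\<omega>. f (X x (s + t) \<omega>)) \<omega> - g (X x s \<omega>)\<bar> \<le> K"
    by eventually_elim (simp add: le)
  from M.abs_integral_diff_le[OF real_cond_exp_int(1)[OF int] P_integrable[OF g gm] this]
  show ?thesis
    by (simp add: trans_sg_def real_cond_exp_int(2)[OF int])
qed

lemma Q_bounded:
  assumes "0 < t" and [measurable]: "f \<in> borel_measurable borel" and bd: "\<And>x. \<bar>f x\<bar> \<le> m"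
  shows "\<bar>Q t f x\<bar> \<le> m"
proof -
  interpret prob_space "\<nu> t" by (rule prob_space_\<nu>[OF \<open>0 < t\<close>])
  have "integrable (\<nu> t) (\<lambda>w. f (x + w))"
    by (rule integrable_bounded_comp[where f = f and m = m and N = borel]) (use bd in auto)
  then show ?thesis
    using abs_integral_diff_le[of "\<lambda>w. f (x + w)" "\<lambda>_. 0" m] bd by (simp add: Q_def)
qed

lemma Q_semigroup:
  assumes st: "0 < s" "0 < t" and [measurable]: "f \<in> borel_measurable borel" and bd: "\<And>x. \<bar>f x\<bar> \<le> m"
  shows "Q (s + t) f x = Q s (Q t f) x"
proof -
  interpret s: prob_space "\<nu> s" by (rule prob_space_\<nu>[OF st(1)])
  interpret t: prob_space "\<nu> t" by (rule prob_space_\<nu>[OF st(2)])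
  interpret pair_prob_space "\<nu> s" "\<nu> t" ..
  \<comment> \<open>The convolution identity is first lifted to an equality of measures, so that it
    applies to signed \<open>f\<close> and Bochner integrals.\<close>
  have "\<nu> (s + t) = distr (\<nu> s \<Otimes>\<^sub>M \<nu> t) borel (\<lambda>p. fst p + snd p)"
  proof (rule measure_eqI)
    fix A assume "A \<in> sets (\<nu> (s + t))"
    then have [measurable]: "A \<in> sets borel" by simp
    have "emeasure (\<nu> (s + t)) A = (\<integral>\<^sup>+ w. indicator A w \<partial>\<nu> (s + t))" by simp
    also have "\<dots> = (\<integral>\<^sup>+ y. \<integral>\<^sup>+ z. indicator A (y + z) \<partial>\<nu> t \<partial>\<nu> s)"
      by (rule subord_law_add[OF W_wiener T0_sub _ st]) simp
    also have "\<dots> = (\<integral>\<^sup>+ p. indicator A (fst p + snd p) \<partial>(\<nu> s \<Otimes>\<^sub>M \<nu> t))"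
      by (subst t.nn_integral_fst[symmetric]) auto
    also have "\<dots> = (\<integral>\<^sup>+ w. indicator A w \<partial>distr (\<nu> s \<Otimes>\<^sub>M \<nu> t) borel (\<lambda>p. fst p + snd p))"
      by (subst nn_integral_distr) auto
    finally show "emeasure (\<nu> (s + t)) A = emeasure (distr (\<nu> s \<Otimes>\<^sub>M \<nu> t) borel (\<lambda>p. fst p + snd p)) A"
      by simp
  qed simp
  then have "Q (s + t) f x = (\<integral> p. f (x + (fst p + snd p)) \<partial>(\<nu> s \<Otimes>\<^sub>M \<nu> t))"
    unfolding Q_def by (simp add: integral_distr)
  also have "\<dots> = (\<integral> y. \<integral> z. f (x + (y + z)) \<partial>\<nu> t \<partial>\<nu> s)"
  proof (subst integral_fst'[symmetric])
    show "integrable (\<nu> s \<Otimes>\<^sub>M \<nu> t) (\<lambda>p. f (x + (fst p + snd p)))"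
      by (rule integrable_bounded_comp[where f = f and m = m and N = borel]) (use bd in auto)
  qed simp
  finally show ?thesis by (simp add: Q_def add.assoc)
qed

section \<open>The singular moment of the subordinator and the gradient bound\<close>

definition \<theta> :: "real \<Rightarrow> ennreal" where
  "\<theta> s = (\<integral>\<^sup>+ \<omega>. ennreal (T0 s \<omega> powr (- 1/2 - \<kappa>)) \<partial>M0)"

text \<open>The summand 1 absorbs the milder powers of \<open>T0 s\<close>, by
  \<open>powr_le_one_plus_powr\<close>.\<close>

definition \<phi> :: "real \<Rightarrow> real" where
  "\<phi> s = 1 + enn2real (\<theta> s)"

lemma \<theta>_antimono: "0 < s \<Longrightarrow> s \<le> t \<Longrightarrow> \<theta> t \<le> \<theta> s"
  unfolding \<theta>_def using \<kappa> T0_pos T0_mono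
  by (intro nn_integral_mono ennreal_leI powr_mono2') (auto intro: less_imp_le)

text \<open>An infinite value at one time would, by monotonicity, be infinite at all earlier
  positive times and contradict \<open>integ\<close>. In particular \<theta> is also finite beyond
  \<delta>.\<close>

lemma \<theta>_finite:
  assumes "0 < s"
  shows "\<theta> s < \<top>"
proof (rule ccontr)
  assume "\<not> \<theta> s < \<top>"
  then have s: "\<theta> s = \<top>" using top.not_eq_extremum by blast
  define u where "u = min s \<delta>"
  have u: "0 < u" "u \<le> s" "u \<le> \<delta>" using assms delta by (auto simp: u_def)
  have top: "\<theta> v = \<top>" if "0 < v" "v \<le> u" for v
    using \<theta>_antimono[of v s] that u s by (simp add: top.extremum_unique)
  have "\<top> = (\<integral>\<^sup>+ v. \<top> * indicator {0<..u} v \<partial>lborel)"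
    using u by (subst nn_integral_cmult) (auto simp: ennreal_top_mult)
  also have "\<dots> \<le> (\<integral>\<^sup>+ v. indicator {0<..\<delta>} v * \<theta> v \<partial>lborel)"
    using top u by (intro nn_integral_mono) (auto split: split_indicator)
  finally show False using integ by (simp add: \<theta>_def)
qed

lemma \<phi>_antimono: "0 < s \<Longrightarrow> s \<le> t \<Longrightarrow> \<phi> t \<le> \<phi> s"
  unfolding \<phi>_def using \<theta>_antimono[of s t] \<theta>_finite[of s] by (simp add: enn2real_mono)

lemma \<phi>_ge_1: "1 \<le> \<phi> s"
  by (simp add: \<phi>_def)

lemma \<phi>_integrable: "set_integrable lborel {0<..\<delta>} \<phi>"
proof -
  \<comment> \<open>Measurability in time comes from monotonicity.\<close>
  have "mono_on {0<..\<delta>} (\<lambda>s. - \<phi> s)" using \<phi>_antimono by (auto simp: mono_on_def)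
  then have "(\<lambda>s. - (- \<phi> s)) \<in> borel_measurable (restrict_space borel {0<..\<delta>})"
    by (intro borel_measurable_uminus borel_measurable_mono_on_fnc)
  then have m [measurable]: "(\<lambda>s. indicator {0<..\<delta>} s *\<^sub>R \<phi> s) \<in> borel_measurable borel"
    by (simp add: borel_measurable_restrict_space_iff)
  have "(\<integral>\<^sup>+ s. ennreal (norm (indicator {0<..\<delta>} s *\<^sub>R \<phi> s)) \<partial>lborel)
     = (\<integral>\<^sup>+ s. indicator {0<..\<delta>} s + indicator {0<..\<delta>} s * \<theta> s \<partial>lborel)"
  proof (intro nn_integral_cong)
    fix s
    have "ennreal (1 + enn2real (\<theta> s)) = 1 + \<theta> s" if "0 < s"
      using \<theta>_finite[OF that] by (simp add: ennreal_enn2real)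
    then show "ennreal (norm (indicator {0<..\<delta>} s *\<^sub>R \<phi> s)) = indicator {0<..\<delta>} s + indicator {0<..\<delta>} s * \<theta> s"
      using \<phi>_ge_1[of s] by (auto simp: \<phi>_def split: split_indicator)
  qed
  also have "\<dots> = (\<integral>\<^sup>+ s. indicator {0<..\<delta>} s \<partial>lborel) + (\<integral>\<^sup>+ s. indicator {0<..\<delta>} s * \<theta> s \<partial>lborel)"
  proof (rule nn_integral_add)
    \<comment> \<open>On the interval \<theta> equals \<open>\<phi> s - 1\<close>, so it inherits
      measurability from \<phi>.\<close>
    have "(\<lambda>s. indicator {0<..\<delta>} s * ennreal (indicator {0<..\<delta>} s *\<^sub>R \<phi> s - 1)) \<in> borel_measurable lborel"
      by measurable
    also have "(\<lambda>s. indicator {0<..\<delta>} s * ennreal (indicator {0<..\<delta>} s *\<^sub>R \<phi> s - 1)) = (\<lambda>s. indicator {0<..\<delta>} s * \<theta> s)"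
      using \<theta>_finite by (auto simp: fun_eq_iff \<phi>_def ennreal_enn2real split: split_indicator)
    finally show "(\<lambda>s. indicator {0<..\<delta>} s * \<theta> s) \<in> borel_measurable lborel" .
  qed simp
  also have "\<dots> < \<infinity>" using integ delta by (simp add: \<theta>_def)
  finally show ?thesis
    unfolding set_integrable_def by (intro integrableI_bounded) (use m in auto)
qed

lemma expectation_T0:
  assumes "0 < s"
  shows "integrable M0 (\<lambda>\<omega>. 1 + T0 s \<omega> powr (- 1/2 - \<kappa>))"
    and "(\<integral> \<omega>. 1 + T0 s \<omega> powr (- 1/2 - \<kappa>) \<partial>M0) = \<phi> s"
proof -
  have "integrable M0 (\<lambda>\<omega>. T0 s \<omega> powr (- 1/2 - \<kappa>))"
    using \<theta>_finite[OF assms] by (intro integrableI_nonneg) (auto simp: \<theta>_def)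
  moreover have "(\<integral> \<omega>. T0 s \<omega> powr (- 1/2 - \<kappa>) \<partial>M0) = enn2real (\<theta> s)"
    unfolding \<theta>_def by (rule integral_eq_nn_integral) auto
  ultimately show "integrable M0 (\<lambda>\<omega>. 1 + T0 s \<omega> powr (- 1/2 - \<kappa>))"
    "(\<integral> \<omega>. 1 + T0 s \<omega> powr (- 1/2 - \<kappa>) \<partial>M0) = \<phi> s"
    by (simp_all add: \<phi>_def M0.prob_space)
qed

text \<open>The power of 2 stems from \<open>gauss_dens_diff_le\<close>. The 4 is a product of two
  factors 2: the two Gaussians in \<open>heat_bounded_lipschitz\<close>, and the merging of powers
  of \<open>T0 s\<close> in \<open>Q_lipschitz\<close>.\<close>

definition C :: real where "C = 4 * 2 powr (real CARD('d) / 2)"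

text \<open>For fixed \<omega> the smoothing is Gaussian with variance \<open>T0 s \<omega>\<close>,
  so the Gaussian estimate is averaged over \<omega>. The bound \<open>m\<close> secures
  integrability, while the constant depends on \<open>N\<close> alone; this is what later permits
  truncation.\<close>

lemma Q_lipschitz:
  assumes "0 < s" and [measurable]: "f \<in> borel_measurable borel" and bd: "\<And>x. \<bar>f x\<bar> \<le> m"
    and hb: "heat_bounded \<kappa> N f" and "0 \<le> N"
  shows "\<bar>Q s f x - Q s f y\<bar> \<le> C * N * \<phi> s * norm (x - y)"
proof -
  have m: "(\<lambda>w. f (z + w)) \<in> borel_measurable borel" for z by measurable
  note I = integral_subord_law[OF W_wiener T0_sub \<open>0 < s\<close> m bd]
  define R where "R = C * N * norm (x - y)"
  have "0 \<le> R" using \<open>0 \<le> N\<close> by (simp add: R_def C_def)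
  have pw: "\<bar>(\<integral> w. f (x + w) \<partial>gauss_vec (T0 s \<omega>)) - (\<integral> w. f (y + w) \<partial>gauss_vec (T0 s \<omega>))\<bar>
      \<le> R * (1 + T0 s \<omega> powr (- 1/2 - \<kappa>))" if "\<omega> \<in> space M0" for \<omega>
  proof -
    define r where "r = T0 s \<omega>"
    have "0 < r" using T0_pos[OF that \<open>0 < s\<close>] by (simp add: r_def)
    have "r powr (- 1/2) * (1 + r powr (- \<kappa>)) = r powr (- 1/2) + r powr (- 1/2 - \<kappa>)"
      by (simp add: distrib_left flip: powr_add)
    also have "\<dots> \<le> 2 * (1 + r powr (- 1/2 - \<kappa>))"
    proof -
      have "r powr (- 1/2) \<le> 1 + r powr (- 1/2 - \<kappa>)"
        by (rule powr_le_one_plus_powr) (use \<kappa> \<open>0 < r\<close> in auto)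
      then show ?thesis using powr_ge_zero[of r "- 1/2 - \<kappa>"] by argo
    qed
    finally have le: "r powr (- 1/2) * (1 + r powr (- \<kappa>)) \<le> 2 * (1 + r powr (- 1/2 - \<kappa>))" .
    have "\<bar>(\<integral> w. f (x + w) \<partial>gauss_vec r) - (\<integral> w. f (y + w) \<partial>gauss_vec r)\<bar>
      \<le> 2 powr (real CARD('d) / 2) * r powr (- 1/2) * norm (x - y) * (2 * (N * (1 + r powr (- \<kappa>))))"
      by (rule heat_bounded_lipschitz[OF _ hb \<open>0 \<le> N\<close> \<kappa> \<open>0 < r\<close>]) measurable
    also have "\<dots> = (2 powr (real CARD('d) / 2) * norm (x - y) * 2 * N) * (r powr (- 1/2) * (1 + r powr (- \<kappa>)))"
      by (simp only: mult_ac)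
    also have "\<dots> \<le> (2 powr (real CARD('d) / 2) * norm (x - y) * 2 * N) * (2 * (1 + r powr (- 1/2 - \<kappa>)))"
      using \<open>0 \<le> N\<close> by (intro mult_left_mono le) auto
    also have "\<dots> = R * (1 + r powr (- 1/2 - \<kappa>))"
      by (simp add: R_def C_def)
    finally show ?thesis by (simp add: r_def)
  qed
  have "\<bar>Q s f x - Q s f y\<bar> = \<bar>\<integral> \<omega>. (\<integral> w. f (x + w) \<partial>gauss_vec (T0 s \<omega>)) - (\<integral> w. f (y + w) \<partial>gauss_vec (T0 s \<omega>)) \<partial>M0\<bar>"
    using I by (simp add: Q_def)
  also have "\<dots> \<le> (\<integral> \<omega>. \<bar>(\<integral> w. f (x + w) \<partial>gauss_vec (T0 s \<omega>)) - (\<integral> w. f (y + w) \<partial>gauss_vec (T0 s \<omega>))\<bar> \<partial>M0)"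
    by (rule integral_abs_bound)
  also have "\<dots> \<le> (\<integral> \<omega>. R * (1 + T0 s \<omega> powr (- 1/2 - \<kappa>)) \<partial>M0)"
    using I expectation_T0[OF \<open>0 < s\<close>]
    by (intro integral_mono integrable_abs Bochner_Integration.integrable_diff integrable_mult_right pw) auto
  also have "\<dots> = R * \<phi> s"
    using expectation_T0(2)[OF \<open>0 < s\<close>] by simp
  finally show ?thesis by (simp add: R_def mult_ac)
qed

lemma Q_le:
  assumes "0 < s" and [measurable]: "f \<in> borel_measurable borel"
    and hb: "heat_bounded \<kappa> N f" and "0 \<le> N"
  shows "\<bar>Q s f x\<bar> \<le> 2 * N * \<phi> s"
proof -
  have "ennreal \<bar>Q s f x\<bar> \<le> (\<integral>\<^sup>+ w. ennreal \<bar>f (x + w)\<bar> \<partial>\<nu> s)"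
  \<comment> \<open>Without integrability the Bochner integral is 0 by convention, and the
    inequality is trivial.\<close>
  proof (cases "integrable (\<nu> s) (\<lambda>w. f (x + w))")
    case True
    from integral_norm_bound_ennreal[OF this] show ?thesis by (simp add: Q_def)
  qed (simp add: Q_def not_integrable_integral_eq)
  also have "\<dots> = (\<integral>\<^sup>+ \<omega>. \<integral>\<^sup>+ w. ennreal \<bar>f (x + w)\<bar> \<partial>gauss_vec (T0 s \<omega>) \<partial>M0)"
    by (rule nn_integral_subord_law[OF T0_sub]) measurable
  also have "\<dots> \<le> (\<integral>\<^sup>+ \<omega>. ennreal (2 * N * (1 + T0 s \<omega> powr (- 1/2 - \<kappa>))) \<partial>M0)"
  proof (intro nn_integral_mono)
    fix \<omega> assume "\<omega> \<in> space M0"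
    then have pos: "0 < T0 s \<omega>" by (rule T0_pos[OF _ \<open>0 < s\<close>])
    have "1 + T0 s \<omega> powr (- \<kappa>) \<le> 2 * (1 + T0 s \<omega> powr (- 1/2 - \<kappa>))"
    proof -
      have "T0 s \<omega> powr (- \<kappa>) \<le> 1 + T0 s \<omega> powr (- 1/2 - \<kappa>)"
        by (rule powr_le_one_plus_powr) (use \<kappa> pos in auto)
      then show ?thesis using powr_ge_zero[of "T0 s \<omega>" "- 1/2 - \<kappa>"] by argo
    qed
    then have "N * (1 + T0 s \<omega> powr (- \<kappa>)) \<le> N * (2 * (1 + T0 s \<omega> powr (- 1/2 - \<kappa>)))"
      using \<open>0 \<le> N\<close> by (intro mult_left_mono) auto
    then show "(\<integral>\<^sup>+ w. ennreal \<bar>f (x + w)\<bar> \<partial>gauss_vec (T0 s \<omega>)) \<le> ennreal (2 * N * (1 + T0 s \<omega> powr (- 1/2 - \<kappa>)))"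
      by (intro order_trans[OF heat_boundedD[OF hb pos]] ennreal_leI) (simp add: mult_ac)
  qed
  also have "\<dots> = ennreal (2 * N * \<phi> s)"
    using expectation_T0[OF \<open>0 < s\<close>] \<open>0 \<le> N\<close>
    by (subst nn_integral_eq_integral) (auto intro!: integrable_mult_right)
  finally show ?thesis
    using \<open>0 \<le> N\<close> \<phi>_ge_1[of s] by (subst (asm) ennreal_le_iff) auto
qed

section \<open>Iterated comparison up to time \<delta> and the strong Feller property\<close>

definition F :: "real \<Rightarrow> real" where
  "F t = (LINT u:{0<..t}|lborel. \<phi> u)"

lemma F_0 [simp]: "F 0 = 0"
  by (simp add: F_def set_lebesgue_integral_def)

lemma F_step: "0 < h \<Longrightarrow> h \<le> s \<Longrightarrow> s \<le> \<delta> \<Longrightarrow> F (s - h) + h * \<phi> s \<le> F s"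
  unfolding F_def by (rule antimono_set_integral_step[OF \<phi>_integrable \<phi>_antimono])

lemma F_tendsto_0: "0 \<le> t \<Longrightarrow> t \<le> \<delta> \<Longrightarrow> (\<lambda>n. F (t / real (Suc n))) \<longlonglongrightarrow> 0"
  unfolding F_def using delta by (intro set_integral_initial_tendsto_0[OF \<phi>_integrable]) auto

lemma F_nonneg: "0 \<le> F t"
  using \<phi>_ge_1 by (auto simp: F_def set_lebesgue_integral_def indicator_def order_trans[OF zero_le_one] intro!: integral_nonneg_AE)

lemma C_nonneg: "0 \<le> C"
  by (simp add: C_def)

lemma heat_bounded_of_bounded:
  fixes f :: "real ^ 'd \<Rightarrow> real"
  assumes f: "f \<in> borel_measurable borel" and bd: "\<And>x. \<bar>f x\<bar> \<le> m"
  shows "heat_bounded \<kappa> m f"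
proof (rule heat_bounded_of_AE_le[OF f])
  show "0 \<le> m" using bd[of 0] by linarith
qed (simp_all add: bd prob_space_gauss_vec[OF W_wiener[of 0]])

lemma Q_continuous:
  assumes "0 < s" and f: "f \<in> borel_measurable borel" and bd: "\<And>x. \<bar>f x\<bar> \<le> m"
  shows "continuous_on UNIV (Q s f)"
proof -
  have "0 \<le> m" using bd[of 0] by linarith
  then have "dist (Q s f x) (Q s f y) \<le> C * m * \<phi> s * dist x y" for x y
    using Q_lipschitz[OF \<open>0 < s\<close> f bd heat_bounded_of_bounded[OF f bd]] by (simp add: dist_real_def dist_norm)
  then have "(C * m * \<phi> s)-lipschitz_on UNIV (Q s f)"
    using \<open>0 \<le> m\<close> C_nonneg \<phi>_ge_1[of s] by (intro lipschitz_onI) auto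
  then show ?thesis by (rule lipschitz_on_continuous_on)
qed

lemma Q_measurable:
  "0 < s \<Longrightarrow> f \<in> borel_measurable borel \<Longrightarrow> (\<And>x. \<bar>f x\<bar> \<le> m) \<Longrightarrow> Q s f \<in> borel_measurable borel"
  by (rule borel_measurable_continuous_onI[OF Q_continuous])

text \<open>One step of length \<open>h\<close> costs \<open>h * B\<close> times the Lipschitz constant of \<open>Q s f\<close>. As \<open>\<phi>\<close> is decreasing,
  the costs add up to at most its integral.\<close>

lemma comparison_iterate:
  assumes f: "f \<in> borel_measurable borel" and bd: "\<And>x. \<bar>f x\<bar> \<le> m"
    and hb: "heat_bounded \<kappa> N f" and "0 \<le> N" and "0 < h"
    and start: "\<And>x. \<bar>P h f x - Q h f x\<bar> \<le> r"
  shows "real (Suc n) * h \<le> \<delta> \<Longrightarrow>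
    \<bar>P (real (Suc n) * h) f x - Q (real (Suc n) * h) f x\<bar> \<le> r + C * B * N * F (real n * h)"
proof (induction n arbitrary: x)
  case 0
  then show ?case using start by simp
next
  case (Suc n)
  define s where "s = real (Suc n) * h"
  have "0 < s" using \<open>0 < h\<close> by (simp add: s_def)
  have "h \<le> s" using \<open>0 < h\<close> by (simp add: s_def)
  have hs: "real (Suc (Suc n)) * h = h + s" by (simp add: s_def algebra_simps)
  have "s \<le> \<delta>" using Suc.prems \<open>0 < h\<close> unfolding hs by simp
  \<comment> \<open>Reaching \<open>real (Suc n) * h\<close> takes \<open>start\<close> and then
    \<open>n\<close> comparison steps, with the gradient bound at the times
    \<open>h, ..., n * h\<close>. Hence \<open>F\<close> lags one step behind, and
    \<open>s - h\<close> is \<open>real n * h\<close>.\<close>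
  have IH: "\<bar>P s f y - Q s f y\<bar> \<le> r + C * B * N * F (s - h)" for y
    using Suc.IH[of y] \<open>s \<le> \<delta>\<close> by (simp add: s_def algebra_simps)
  have "\<bar>P (h + s) f x - P h (Q s f) x\<bar> \<le> r + C * B * N * F (s - h)"
    using \<open>0 < h\<close> \<open>0 < s\<close>
    by (intro markov_approx[OF _ _ f bd Q_measurable[OF \<open>0 < s\<close> f bd] Q_bounded[OF \<open>0 < s\<close> f bd] IH]) auto
  moreover have "\<bar>P h (Q s f) x - Q h (Q s f) x\<bar> \<le> h * B * (C * N * \<phi> s)"
    using C_nonneg \<open>0 \<le> N\<close> \<phi>_ge_1[of s]
    by (intro one_step[OF \<open>0 < h\<close> Q_measurable[OF \<open>0 < s\<close> f bd] Q_bounded[OF \<open>0 < s\<close> f bd] Q_lipschitz[OF \<open>0 < s\<close> f bd hb \<open>0 \<le> N\<close>]]) auto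
  moreover have "Q (h + s) f x = Q h (Q s f) x"
    by (rule Q_semigroup[OF \<open>0 < h\<close> \<open>0 < s\<close> f bd])
  moreover have "C * B * N * (F (s - h) + h * \<phi> s) \<le> C * B * N * F s"
    using C_nonneg B_nonneg \<open>0 \<le> N\<close> F_step[OF \<open>0 < h\<close> \<open>h \<le> s\<close> \<open>s \<le> \<delta>\<close>] by (intro mult_left_mono) auto
  ultimately have "\<bar>P (h + s) f x - Q (h + s) f x\<bar> \<le> r + C * B * N * F s"
    by (simp add: algebra_simps)
  then show ?case unfolding hs by (simp add: s_def)
qed

text \<open>Once \<open>F (t - h)\<close> is bounded by \<open>F t\<close>, the mesh enters only
  through the initial error \<open>r n\<close>. That it vanishes is a premise because it is
  established in two ways: by \<open>one_step\<close> for Lipschitz \<open>f\<close>, and then by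
  \<open>comparison_bounded\<close> for bounded Borel \<open>f\<close>.\<close>

lemma comparison:
  assumes f: "f \<in> borel_measurable borel" and bd: "\<And>x. \<bar>f x\<bar> \<le> m"
    and hb: "heat_bounded \<kappa> N f" and "0 \<le> N" and t: "0 < t" "t \<le> \<delta>"
    and start: "\<And>n x. \<bar>P (t / real (Suc n)) f x - Q (t / real (Suc n)) f x\<bar> \<le> r n"
    and r: "r \<longlonglongrightarrow> 0"
  shows "\<bar>P t f x - Q t f x\<bar> \<le> C * B * N * F t"
proof (rule LIMSEQ_le_const)
  show "(\<lambda>n. r n + C * B * N * F t) \<longlonglongrightarrow> C * B * N * F t"
    using tendsto_add[OF r tendsto_const] by simp
  show "\<exists>N'. \<forall>n\<ge>N'. \<bar>P t f x - Q t f x\<bar> \<le> r n + C * B * N * F t"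
  proof (intro exI allI impI)
    fix n :: nat
    define h where "h = t / real (Suc n)"
    have h: "0 < h" "h \<le> t" "real (Suc n) * h = t" and nh: "real n * h = t - h"
      using t by (auto simp: h_def divide_simps algebra_simps)
    have "\<bar>P t f x - Q t f x\<bar> \<le> r n + C * B * N * F (t - h)"
      using comparison_iterate[OF f bd hb \<open>0 \<le> N\<close> h(1), of "r n" n x] start[of n] t
      unfolding h(3) nh by (simp add: h_def)
    also have "F (t - h) \<le> F t"
      using F_step[OF h(1,2) t(2)] \<phi>_ge_1[of t] h(1) mult_nonneg_nonneg[of h "\<phi> t"] by linarith
    finally show "\<bar>P t f x - Q t f x\<bar> \<le> r n + C * B * N * F t"
      using C_nonneg B_nonneg \<open>0 \<le> N\<close> by (simp add: mult_left_mono)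
  qed
qed

text \<open>The initial error is at most \<open>t * B * L / Suc n\<close> by
  \<open>one_step\<close>, so \<open>L\<close> disappears in the limit.\<close>

lemma comparison_lipschitz:
  assumes f01: "\<And>x. 0 \<le> f x \<and> f x \<le> 1" and "0 \<le> L" and lip: "\<And>x y. \<bar>f x - f y\<bar> \<le> L * dist x y"
    and t: "0 < t" "t \<le> \<delta>"
  shows "\<bar>P t f x - Q t f x\<bar> \<le> C * B * F t"
proof -
  have "L-lipschitz_on UNIV f" using lip \<open>0 \<le> L\<close> by (intro lipschitz_onI) (auto simp: dist_real_def)
  then have f: "f \<in> borel_measurable borel"
    by (intro borel_measurable_continuous_onI lipschitz_on_continuous_on)
  have bd: "\<bar>f x\<bar> \<le> 1" for x using f01[of x] by simp
  have "\<bar>P t f x - Q t f x\<bar> \<le> C * B * 1 * F t"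
  proof (rule comparison[OF f bd heat_bounded_of_bounded[OF f bd] _ t])
    show "\<bar>P (t / real (Suc n)) f x - Q (t / real (Suc n)) f x\<bar> \<le> t * B * L * inverse (real (Suc n))" for n x
      using one_step[OF _ f bd _ \<open>0 \<le> L\<close>, of "t / real (Suc n)" x] lip t by (simp add: dist_norm divide_inverse mult_ac)
    show "(\<lambda>n. t * B * L * inverse (real (Suc n))) \<longlonglongrightarrow> 0"
      using tendsto_mult[OF tendsto_const LIMSEQ_inverse_real_of_nat] by simp
  qed simp
  then show ?thesis by simp
qed

text \<open>Since \<open>comparison_lipschitz\<close> is uniform in \<open>L\<close>, it bounds the
  total variation distance between the law of \<open>X x t\<close> and that of the noise started at
  \<open>x\<close>.\<close>

lemma comparison_bounded:
  assumes f [measurable]: "f \<in> borel_measurable borel" and bd: "\<And>x. \<bar>f x\<bar> \<le> m" and "0 < m"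
    and t: "0 < t" "t \<le> \<delta>"
  shows "\<bar>P t f x - Q t f x\<bar> \<le> 2 * m * (C * B * F t)"
proof -
  let ?\<mu> = "distr (M x) borel (X x t)" and ?\<rho> = "distr (\<nu> t) borel (\<lambda>w. x + w)"
  interpret \<nu>: prob_space "\<nu> t" by (rule prob_space_\<nu>[OF t(1)])
  have eq: "(\<integral> y. g y \<partial>?\<mu>) = P t g x" "(\<integral> y. g y \<partial>?\<rho>) = Q t g x" if "g \<in> borel_measurable borel" for g :: "real ^ 'd \<Rightarrow> real"
    using that by (auto simp: integral_distr trans_sg_def Q_def)
  have "\<bar>(\<integral> y. f y \<partial>?\<mu>) - (\<integral> y. f y \<partial>?\<rho>)\<bar> \<le> 2 * m * (C * B * F t)"
  proof (rule lipschitz_test_imp_bounded_test[OF _ _ _ _ _ f bd \<open>0 < m\<close>])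
    show "prob_space ?\<mu>" by (rule M.prob_space_distr) simp
    show "prob_space ?\<rho>" by (rule \<nu>.prob_space_distr) simp
    fix g :: "real ^ 'd \<Rightarrow> real" and L
    assume g: "\<And>x. 0 \<le> g x \<and> g x \<le> 1" "0 \<le> L" "\<And>x y. \<bar>g x - g y\<bar> \<le> L * dist x y"
    then have "L-lipschitz_on UNIV g" by (intro lipschitz_onI) (auto simp: dist_real_def)
    then have "g \<in> borel_measurable borel"
      by (intro borel_measurable_continuous_onI lipschitz_on_continuous_on)
    with comparison_lipschitz[OF g t, of x]
    show "\<bar>(\<integral> y. g y \<partial>?\<mu>) - (\<integral> y. g y \<partial>?\<rho>)\<bar> \<le> C * B * F t" by (simp add: eq)
  qed simp_all
  then show ?thesis by (simp add: eq)
qed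

lemma strong_feller:
  assumes f: "f \<in> borel_measurable borel" and bd: "\<And>x. \<bar>f x\<bar> \<le> m" and "0 < t"
  shows "continuous_on UNIV (P t f)"
proof (rule continuous_on_uniform_approx)
  fix e :: real assume "0 < e"
  \<comment> \<open>The comparison reaches only up to \<delta>, so the small time \<open>s\<close>
    is taken below both \<open>t\<close> and \<delta>; the Markov property covers the remaining
    \<open>t - s\<close>.\<close>
  define t' where "t' = min t \<delta>"
  have t': "0 < t'" "t' \<le> t" "t' \<le> \<delta>" using \<open>0 < t\<close> delta by (auto simp: t'_def)
  \<comment> \<open>\<open>comparison_bounded\<close> asks for a strictly positive bound.\<close>
  have bd': "\<bar>f x\<bar> \<le> \<bar>m\<bar> + 1" for x using bd[of x] by linarith
  have "(\<lambda>n. 2 * (\<bar>m\<bar> + 1) * (C * B * F (t' / real (Suc n)))) \<longlonglongrightarrow> 2 * (\<bar>m\<bar> + 1) * (C * B * 0)"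
    using t' by (intro tendsto_intros F_tendsto_0) auto
  then have "\<forall>\<^sub>F n in sequentially. 2 * (\<bar>m\<bar> + 1) * (C * B * F (t' / real (Suc n))) < e"
    using \<open>0 < e\<close> by (intro order_tendstoD(2)) auto
  then obtain n where n: "2 * (\<bar>m\<bar> + 1) * (C * B * F (t' / real (Suc n))) < e"
    by (auto simp: eventually_sequentially)
  define s where "s = t' / real (Suc n)"
  have "t' / real (Suc n) \<le> t' / 1" using t' by (intro divide_left_mono) auto
  then have s: "0 < s" "s \<le> t" "s \<le> \<delta>" using t' by (auto simp: s_def)
  have "\<bar>P s f y - Q s f y\<bar> \<le> e" for y
  proof -
    have "\<bar>P s f y - Q s f y\<bar> \<le> 2 * (\<bar>m\<bar> + 1) * (C * B * F s)"
      by (rule comparison_bounded[OF f bd' _ s(1,3)]) simp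
    then show ?thesis using n by (simp add: s_def)
  qed
  then have "\<bar>P ((t - s) + s) f x - P (t - s) (Q s f) x\<bar> \<le> e" for x
    using s by (intro markov_approx[OF _ _ f bd Q_measurable[OF s(1) f bd] Q_bounded[OF s(1) f bd]]) auto
  moreover have "continuous_on UNIV (P (t - s) (Q s f))"
    using s Q_bounded[OF s(1) f bd] by (intro feller Q_continuous[OF s(1) f bd]) (auto simp: bounded_iff)
  ultimately show "\<exists>g. continuous_on UNIV g \<and> (\<forall>x\<in>UNIV. \<bar>P t f x - g x\<bar> \<le> e)"
    by auto
qed

text \<open>A bootstrap: \<open>comparison_bounded\<close> makes the initial error vanish for every
  bounded Borel \<open>f\<close>, and running the iteration again replaces the sup bound
  \<open>m\<close> by \<open>N\<close>.\<close>

lemma comparison_heat_bounded: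
  assumes f: "f \<in> borel_measurable borel" and bd: "\<And>x. \<bar>f x\<bar> \<le> m"
    and hb: "heat_bounded \<kappa> N f" and "0 \<le> N" and t: "0 < t" "t \<le> \<delta>"
  shows "\<bar>P t f x - Q t f x\<bar> \<le> C * B * N * F t"
proof (rule comparison[OF f bd hb \<open>0 \<le> N\<close> t])
  have bd': "\<bar>f x\<bar> \<le> \<bar>m\<bar> + 1" for x using bd[of x] by linarith
  show "\<bar>P (t / real (Suc n)) f x - Q (t / real (Suc n)) f x\<bar> \<le> 2 * (\<bar>m\<bar> + 1) * (C * B * F (t / real (Suc n)))" for n x
  proof (rule comparison_bounded[OF f bd'])
    have "t / real (Suc n) \<le> t / 1" using t by (intro divide_left_mono) auto
    then show "t / real (Suc n) \<le> \<delta>" using t by simp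
  qed (use t in auto)
  have "(\<lambda>n. 2 * (\<bar>m\<bar> + 1) * (C * B * F (t / real (Suc n)))) \<longlonglongrightarrow> 2 * (\<bar>m\<bar> + 1) * (C * B * 0)"
    using t by (intro tendsto_intros F_tendsto_0) auto
  then show "(\<lambda>n. 2 * (\<bar>m\<bar> + 1) * (C * B * F (t / real (Suc n)))) \<longlonglongrightarrow> 0" by simp
qed

section \<open>Extension to unbounded functions\<close>

definition D :: "real \<Rightarrow> real" where
  "D t = 2 * \<phi> (min t \<delta>) + C * B * F (min t \<delta>)"

lemma D_nonneg: "0 \<le> D t"
  using \<phi>_ge_1[of "min t \<delta>"] C_nonneg B_nonneg F_nonneg by (simp add: D_def)

text \<open>At time \<open>min t \<delta>\<close> the bound is the sum of \<open>Q_le\<close> and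
  the comparison error, which explains the form of \<open>D\<close>.\<close>

lemma P_le_bounded:
  assumes f: "f \<in> borel_measurable borel" and bd: "\<And>x. \<bar>f x\<bar> \<le> m"
    and hb: "heat_bounded \<kappa> N f" and "0 \<le> N" and "0 < t"
  shows "\<bar>P t f x\<bar> \<le> D t * N"
proof -
  define t' where "t' = min t \<delta>"
  have t': "0 < t'" "t' \<le> t" "t' \<le> \<delta>" using \<open>0 < t\<close> delta by (auto simp: t'_def)
  have "\<bar>P t' f y - 0\<bar> \<le> D t * N" for y
    using comparison_heat_bounded[OF f bd hb \<open>0 \<le> N\<close> t'(1,3), of y] Q_le[OF t'(1) f hb \<open>0 \<le> N\<close>, of y]
    by (simp add: D_def t'_def[symmetric] algebra_simps)
  \<comment> \<open>\<open>markov_approx\<close> with the zero function as approximation: a sup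
    bound at time \<open>t'\<close> persists at the later time \<open>t\<close>.\<close>
  then have "\<bar>P ((t - t') + t') f x - P (t - t') (\<lambda>_. 0) x\<bar> \<le> D t * N"
    using t' by (intro markov_approx[OF _ _ f bd, where m' = 0]) auto
  then show ?thesis by (simp add: trans_sg_def)
qed

text \<open>The constant in \<open>P_le_bounded\<close> does not depend on the truncation level, so
  monotone convergence removes the boundedness. The integral is an \<open>ennreal\<close> one
  because integrability is only deduced from it.\<close>

lemma nn_integral_P_le:
  assumes f [measurable]: "f \<in> borel_measurable borel"
    and hb: "heat_bounded \<kappa> N f" and "0 \<le> N" and "0 < t"
  shows "(\<integral>\<^sup>+ \<omega>. ennreal \<bar>f (X x t \<omega>)\<bar> \<partial>M x) \<le> ennreal (D t * N)"
proof -
  define g where "g n y = min \<bar>f y\<bar> (real n)" for n y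
  have [measurable]: "g n \<in> borel_measurable borel" for n unfolding g_def by measurable
  have g0: "0 \<le> g n y" "\<bar>g n y\<bar> \<le> real n" "g n y \<le> \<bar>f y\<bar>" for n y by (auto simp: g_def)
  have ghb: "heat_bounded \<kappa> N (g n)" for n
    unfolding heat_bounded_def
  proof (intro allI impI)
    fix r :: real and z :: "real ^ 'd" assume "0 < r"
    have "(\<integral>\<^sup>+ w. ennreal \<bar>g n (z + w)\<bar> \<partial>gauss_vec r) \<le> (\<integral>\<^sup>+ w. ennreal \<bar>f (z + w)\<bar> \<partial>gauss_vec r)"
      using g0 by (intro nn_integral_mono ennreal_leI) auto
    also have "\<dots> \<le> ennreal (N * (1 + r powr (- \<kappa>)))" by (rule heat_boundedD[OF hb \<open>0 < r\<close>])
    finally show "(\<integral>\<^sup>+ w. ennreal \<bar>g n (z + w)\<bar> \<partial>gauss_vec r) \<le> ennreal (N * (1 + r powr (- \<kappa>)))" .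
  qed
  have sup: "(SUP n. ennreal (g n y)) = ennreal \<bar>f y\<bar>" for y
  proof (rule antisym)
    show "(SUP n. ennreal (g n y)) \<le> ennreal \<bar>f y\<bar>" using g0 by (intro SUP_least ennreal_leI) auto
    obtain n where "\<bar>f y\<bar> \<le> real n" using real_arch_simple by blast
    then have "ennreal \<bar>f y\<bar> = ennreal (g n y)" by (simp add: g_def)
    then show "ennreal \<bar>f y\<bar> \<le> (SUP n. ennreal (g n y))" by (metis SUP_upper UNIV_I)
  qed
  have "(\<integral>\<^sup>+ \<omega>. ennreal \<bar>f (X x t \<omega>)\<bar> \<partial>M x) = (\<integral>\<^sup>+ \<omega>. (SUP n. ennreal (g n (X x t \<omega>))) \<partial>M x)"
    by (simp only: sup)
  also have "\<dots> = (SUP n. \<integral>\<^sup>+ \<omega>. ennreal (g n (X x t \<omega>)) \<partial>M x)"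
    by (intro nn_integral_monotone_convergence_SUP) (auto intro!: ennreal_leI simp: incseq_def le_fun_def g_def min_def)
  also have "\<dots> \<le> ennreal (D t * N)"
  proof (rule SUP_least)
    fix n
    have "(\<integral>\<^sup>+ \<omega>. ennreal (g n (X x t \<omega>)) \<partial>M x) = ennreal (P t (g n) x)"
      unfolding trans_sg_def using g0 by (intro nn_integral_eq_integral P_integrable[where m = "real n"]) auto
    also have "\<dots> \<le> ennreal (D t * N)"
      using P_le_bounded[OF _ g0(2) ghb \<open>0 \<le> N\<close> \<open>0 < t\<close>, of n x] by (intro ennreal_leI) auto
    finally show "(\<integral>\<^sup>+ \<omega>. ennreal (g n (X x t \<omega>)) \<partial>M x) \<le> ennreal (D t * N)" .
  qed
  finally show ?thesis .
qed

text \<open>The function in \<open>hb\<close> is exactly the error of truncating \<open>f\<close> at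
  level \<open>n\<close>. By \<open>nn_integral_P_le\<close> the images of the truncations under
  \<open>P t\<close> converge uniformly, and each is continuous by
  \<open>strong_feller\<close>.\<close>

lemma heat_regular:
  assumes f [measurable]: "f \<in> borel_measurable borel" and "0 < t"
    and hb: "\<And>n. heat_bounded \<kappa> (N n) (\<lambda>y. max 0 (\<bar>f y\<bar> - real n))" and N0: "\<And>n. 0 \<le> N n" and N: "N \<longlonglongrightarrow> 0"
  shows "integrable (M x) (\<lambda>\<omega>. f (X x t \<omega>))"
    and "continuous_on UNIV (P t f)" and "bounded (range (P t f))"
proof -
  \<comment> \<open>At level 0 the tail is the absolute value of \<open>f\<close>.\<close>
  have "heat_bounded \<kappa> (N 0) f"
    using hb[of 0] by (simp add: heat_bounded_def max_def)
  note le = nn_integral_P_le[OF f this N0 \<open>0 < t\<close>]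
  have int: "integrable (M x) (\<lambda>\<omega>. f (X x t \<omega>))" for x
  proof (rule integrableI_bounded)
    show "(\<integral>\<^sup>+ \<omega>. ennreal (norm (f (X x t \<omega>))) \<partial>M x) < \<infinity>"
      using le[of x] by (simp add: order_le_less_trans)
  qed simp
  then show "integrable (M x) (\<lambda>\<omega>. f (X x t \<omega>))" .
  have "\<bar>P t f x\<bar> \<le> D t * N 0" for x
  proof -
    have "ennreal \<bar>P t f x\<bar> \<le> ennreal (D t * N 0)"
      using integral_norm_bound_ennreal[OF int, of x] le[of x] by (simp add: trans_sg_def)
    then show ?thesis using D_nonneg N0 by (subst (asm) ennreal_le_iff) auto
  qed
  then show "bounded (range (P t f))" by (auto simp: bounded_iff)
  show "continuous_on UNIV (P t f)"
  proof (rule continuous_on_uniform_approx)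
    fix e :: real assume "0 < e"
    have "(\<lambda>n. D t * N n) \<longlonglongrightarrow> D t * 0" by (intro tendsto_intros N)
    then have "\<forall>\<^sub>F n in sequentially. D t * N n < e"
      using \<open>0 < e\<close> by (intro order_tendstoD(2)) auto
    then obtain n where n: "D t * N n < e" by (auto simp: eventually_sequentially)
    define g where "g y = max (- real n) (min (f y) (real n))" for y
    have g [measurable]: "g \<in> borel_measurable borel" unfolding g_def by measurable
    have gm: "\<bar>g y\<bar> \<le> real n" for y by (auto simp: g_def)
    have fg: "\<bar>f y - g y\<bar> = \<bar>max 0 (\<bar>f y\<bar> - real n)\<bar>" for y by (auto simp: g_def)
    have "\<bar>P t f x - P t g x\<bar> \<le> e" for x
    proof -
      have gi: "integrable (M x) (\<lambda>\<omega>. g (X x t \<omega>))" by (rule P_integrable[OF g gm])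
      have "ennreal \<bar>P t f x - P t g x\<bar> = ennreal (norm (\<integral> \<omega>. f (X x t \<omega>) - g (X x t \<omega>) \<partial>M x))"
        using int gi by (simp add: trans_sg_def)
      also have "\<dots> \<le> (\<integral>\<^sup>+ \<omega>. ennreal (norm (f (X x t \<omega>) - g (X x t \<omega>))) \<partial>M x)"
        using int gi by (intro integral_norm_bound_ennreal) auto
      also have "\<dots> \<le> ennreal (D t * N n)"
        using nn_integral_P_le[OF _ hb N0 \<open>0 < t\<close>, of n x] by (simp add: fg)
      finally have "\<bar>P t f x - P t g x\<bar> \<le> D t * N n"
        using D_nonneg N0 by (subst (asm) ennreal_le_iff) auto
      then show ?thesis using n by simp
    qed
    then show "\<exists>g. continuous_on UNIV g \<and> (\<forall>x\<in>UNIV. \<bar>P t f x - g x\<bar> \<le> e)"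
      using strong_feller[OF g gm \<open>0 < t\<close>] by auto
  qed
qed

end

section \<open>Functions in \<open>L\<^sub>p\<close>\<close>

text \<open>Below the level \<open>l\<close> the first term suffices; above it
  \<open>a powr (1 - q)\<close> is at most \<open>l powr (1 - q)\<close>. With \<open>l\<close>
  chosen well this takes the place of Jensen's inequality, at the price of a factor 2.\<close>

lemma le_plus_scaled_powr:
  fixes a l q :: real
  assumes "0 \<le> a" "0 < l" "1 \<le> q"
  shows "a \<le> l + l powr (1 - q) * a powr q"
proof (cases "a \<le> l")
  case True
  moreover have "0 \<le> l powr (1 - q) * a powr q" by simp
  ultimately show ?thesis by linarith
next
  case False
  then have "0 < a" "l \<le> a" using assms by auto
  then have "a powr (1 - q) \<le> l powr (1 - q)"
    using assms powr_mono2'[of "1 - q" l a] by simp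
  then have "a powr (1 - q) * a powr q \<le> l powr (1 - q) * a powr q"
    by (intro mult_right_mono) auto
  moreover have "a powr (1 - q) * a powr q = a"
    using \<open>0 < a\<close> by (simp flip: powr_add)
  ultimately show ?thesis using \<open>0 < l\<close> by linarith
qed

text \<open>The Gaussian density is at most \<open>r powr (- d / 2)\<close>, so the
  \<open>q\<close>-th moment of \<open>g\<close> under the shifted Gaussian is at most
  \<open>r powr (- d / 2) * J\<close>. The first moment follows by
  \<open>le_plus_scaled_powr\<close>.\<close>

lemma heat_bounded_of_Lq:
  fixes g :: "real ^ 'd::finite \<Rightarrow> real"
  assumes [measurable]: "g \<in> borel_measurable borel" and q: "1 \<le> q" and J: "0 < J"
    and le: "(\<integral>\<^sup>+ z. ennreal (\<bar>g z\<bar> powr q) \<partial>lborel) \<le> ennreal J"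
    and ps: "\<And>r. 0 < r \<Longrightarrow> prob_space (gauss_vec r :: (real ^ 'd) measure)"
  shows "heat_bounded (real CARD('d) / q / 2) (2 * J powr (1 / q)) g"
  unfolding heat_bounded_def
proof (intro allI impI)
  fix r :: real and x :: "real ^ 'd" assume r: "0 < r"
  interpret prob_space "gauss_vec r :: (real ^ 'd) measure" by (rule ps[OF r])
  define d where "d = real CARD('d)"
  define \<kappa> where "\<kappa> = d / q / 2"
  \<comment> \<open>This level balances the two terms of \<open>le_plus_scaled_powr\<close>: with
    the moment bound inserted, the second one also equals \<open>l\<close>, as \<open>lq\<close>
    states. Positivity of \<open>J\<close> makes \<open>l\<close> positive.\<close>
  define l where "l = J powr (1 / q) * r powr (- \<kappa>)"
  have "0 < l" using J r by (simp add: l_def)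
  have "l powr (- q) = J powr (- 1) * r powr (d / 2)"
    unfolding l_def using q J r by (simp add: powr_mult powr_powr \<kappa>_def)
  then have lq: "l powr (1 - q) * (r powr (- d / 2) * J) = l"
    using powr_add[of l 1 "- q"] \<open>0 < l\<close> J r by (simp add: powr_minus field_simps)
  have dens: "gauss_dens r z \<le> r powr (- d / 2)" for z :: "real ^ 'd"
  proof -
    have "gauss_dens r z \<le> (2 * pi * r) powr (- d / 2) * 1"
      unfolding gauss_dens_def d_def using r by (intro mult_left_mono) auto
    also have "\<dots> \<le> r powr (- d / 2)"
    proof -
      have "1 * r \<le> (2 * pi) * r" using pi_ge_two r by (intro mult_right_mono) auto
      then show ?thesis using r by (simp add: d_def powr_mono2')
    qed
    finally show ?thesis .
  qed
  have "(\<integral>\<^sup>+ w. ennreal (\<bar>g (x + w)\<bar> powr q) \<partial>gauss_vec r) = (\<integral>\<^sup>+ z. ennreal (gauss_dens r (z - x)) * ennreal (\<bar>g z\<bar> powr q) \<partial>lborel)"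
    by (rule nn_integral_gauss_vec_shift) measurable
  also have "\<dots> \<le> (\<integral>\<^sup>+ z. ennreal (r powr (- d / 2)) * ennreal (\<bar>g z\<bar> powr q) \<partial>lborel)"
    by (intro nn_integral_mono mult_right_mono ennreal_leI dens) auto
  also have "\<dots> = ennreal (r powr (- d / 2)) * (\<integral>\<^sup>+ z. ennreal (\<bar>g z\<bar> powr q) \<partial>lborel)"
    by (rule nn_integral_cmult) measurable
  also have "\<dots> \<le> ennreal (r powr (- d / 2)) * ennreal J"
    by (intro mult_left_mono le) simp
  finally have 1: "(\<integral>\<^sup>+ w. ennreal (\<bar>g (x + w)\<bar> powr q) \<partial>gauss_vec r) \<le> ennreal (r powr (- d / 2) * J)"
    using J by (simp add: ennreal_mult)
  have "(\<integral>\<^sup>+ w. ennreal \<bar>g (x + w)\<bar> \<partial>gauss_vec r)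
      \<le> (\<integral>\<^sup>+ w. ennreal l + ennreal (l powr (1 - q)) * ennreal (\<bar>g (x + w)\<bar> powr q) \<partial>gauss_vec r)"
  proof (intro nn_integral_mono)
    fix w
    have "ennreal \<bar>g (x + w)\<bar> \<le> ennreal (l + l powr (1 - q) * \<bar>g (x + w)\<bar> powr q)"
      using q \<open>0 < l\<close> by (intro ennreal_leI le_plus_scaled_powr) auto
    then show "ennreal \<bar>g (x + w)\<bar> \<le> ennreal l + ennreal (l powr (1 - q)) * ennreal (\<bar>g (x + w)\<bar> powr q)"
      using \<open>0 < l\<close> by (simp add: ennreal_mult)
  qed
  also have "\<dots> = ennreal l + ennreal (l powr (1 - q)) * (\<integral>\<^sup>+ w. ennreal (\<bar>g (x + w)\<bar> powr q) \<partial>gauss_vec r)"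
    using emeasure_space_1 by (simp add: nn_integral_add nn_integral_cmult)
  also have "\<dots> \<le> ennreal l + ennreal (l powr (1 - q)) * ennreal (r powr (- d / 2) * J)"
    by (intro add_left_mono mult_left_mono 1) simp
  also have "\<dots> = ennreal (l + l)"
    using J \<open>0 < l\<close> lq by (simp flip: ennreal_mult ennreal_plus)
  also have "\<dots> \<le> ennreal (2 * J powr (1 / q) * (1 + r powr (- \<kappa>)))"
    by (intro ennreal_leI) (simp add: l_def distrib_left)
  finally show "(\<integral>\<^sup>+ w. ennreal \<bar>g (x + w)\<bar> \<partial>gauss_vec r)
      \<le> ennreal (2 * J powr (1 / q) * (1 + r powr - (real CARD('d) / q / 2)))"
    by (simp add: \<kappa>_def d_def)
qed

text \<open>For infinite \<open>p\<close> the tail vanishes almost everywhere once the level exceeds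
  an essential bound. For finite \<open>p\<close> its norm tends to 0 by dominated
  convergence.\<close>

lemma Lp_fun_heat_bounded_tail:
  fixes f :: "real ^ 'd::finite \<Rightarrow> real"
  assumes p: "1 \<le> p" and f: "Lp_fun p f"
    and ps: "\<And>r. 0 < r \<Longrightarrow> prob_space (gauss_vec r :: (real ^ 'd) measure)"
  obtains N where "\<And>n. heat_bounded (d_over_p CARD('d) p / 2) (N n) (\<lambda>y. max 0 (\<bar>f y\<bar> - real n))"
    "\<And>n. 0 \<le> N n" "N \<longlonglongrightarrow> 0"
proof -
  have [measurable]: "f \<in> borel_measurable borel" using f by (simp add: Lp_fun_def)
  define g where "g n y = max 0 (\<bar>f y\<bar> - real n)" for n y
  have [measurable]: "g n \<in> borel_measurable borel" for n unfolding g_def by measurable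
  show ?thesis
  proof (cases "p = \<top>")
    case True
    then obtain K where K: "AE x in lborel. \<bar>f x\<bar> \<le> K" using f by (auto simp: Lp_fun_def)
    show ?thesis
    proof (rule that[of "\<lambda>n. max 0 (K - real n)"])
      fix n
      have "AE z in lborel. \<bar>g n z\<bar> \<le> max 0 (K - real n)"
        using K by eventually_elim (auto simp: g_def)
      then show "heat_bounded (d_over_p CARD('d) p / 2) (max 0 (K - real n)) (\<lambda>y. max 0 (\<bar>f y\<bar> - real n))"
        by (intro heat_bounded_of_AE_le ps) (auto simp: g_def)
    next
      obtain k where "K \<le> real k" using real_arch_simple by blast
      then have "\<forall>\<^sub>F n in sequentially. max 0 (K - real n) = 0"
        unfolding eventually_sequentially by (intro exI[of _ k]) auto
      then show "(\<lambda>n. max 0 (K - real n)) \<longlonglongrightarrow> 0" by (rule tendsto_eventually)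
    qed simp
  next
    case False
    define q where "q = enn2real p"
    have "ennreal q = p" using False by (simp add: q_def ennreal_enn2real top.not_eq_extremum)
    then have q: "1 \<le> q" using p by (metis ennreal_1 ennreal_le_iff ennreal_neg linorder_le_cases not_one_le_zero zero_le_one order.trans)
    have fin: "(\<integral>\<^sup>+ x. ennreal (\<bar>f x\<bar> powr q) \<partial>lborel) < \<infinity>"
      using f False by (simp add: Lp_fun_def q_def)
    define I where "I n = (\<integral> x. \<bar>g n x\<bar> powr q \<partial>lborel)" for n
    have gle: "\<bar>g n x\<bar> powr q \<le> \<bar>f x\<bar> powr q" for n x
      using q by (intro powr_mono2) (auto simp: g_def)
    have fi: "integrable lborel (\<lambda>x. \<bar>f x\<bar> powr q)"
      using fin by (intro integrableI_nonneg) auto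
    have gi: "integrable lborel (\<lambda>x. \<bar>g n x\<bar> powr q)" for n
      using gle by (intro Bochner_Integration.integrable_bound[OF fi]) auto
    have I0: "0 \<le> I n" for n unfolding I_def by (intro integral_nonneg_AE) auto
    have "I \<longlonglongrightarrow> (\<integral> x. 0 \<partial>(lborel :: (real ^ 'd) measure))"
      unfolding I_def
    proof (rule integral_dominated_convergence[OF _ _ fi])
      show "AE x in lborel. (\<lambda>n. \<bar>g n x\<bar> powr q) \<longlonglongrightarrow> 0"
      proof (intro always_eventually allI)
        fix x
        obtain k where "\<bar>f x\<bar> \<le> real k" using real_arch_simple by blast
        then have "\<forall>\<^sub>F n in sequentially. \<bar>g n x\<bar> powr q = 0"
          unfolding eventually_sequentially by (intro exI[of _ k]) (auto simp: g_def)
        then show "(\<lambda>n. \<bar>g n x\<bar> powr q) \<longlonglongrightarrow> 0" by (rule tendsto_eventually)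
      qed
    qed (use gle in auto)
    then have I: "I \<longlonglongrightarrow> 0" by simp
    \<comment> \<open>The added \<open>inverse (real (Suc n))\<close> keeps \<open>J n\<close>
      positive, as \<open>heat_bounded_of_Lq\<close> demands, even where the tail integral is
      0.\<close>
    define J where "J n = I n + inverse (real (Suc n))" for n
    have J0: "0 < J n" for n using I0[of n] by (simp add: J_def add_nonneg_pos)
    have J: "J \<longlonglongrightarrow> 0"
      unfolding J_def using tendsto_add[OF I LIMSEQ_inverse_real_of_nat] by simp
    show ?thesis
    proof (rule that[of "\<lambda>n. 2 * J n powr (1 / q)"])
      fix n
      have "(\<integral>\<^sup>+ z. ennreal (\<bar>g n z\<bar> powr q) \<partial>lborel) = ennreal (I n)"
        unfolding I_def by (rule nn_integral_eq_integral[OF gi]) auto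
      then have "(\<integral>\<^sup>+ z. ennreal (\<bar>g n z\<bar> powr q) \<partial>lborel) \<le> ennreal (J n)"
        by (simp add: J_def ennreal_leI)
      from heat_bounded_of_Lq[OF _ q J0 this ps]
      show "heat_bounded (d_over_p CARD('d) p / 2) (2 * J n powr (1 / q)) (\<lambda>y. max 0 (\<bar>f y\<bar> - real n))"
        using False by (simp add: d_over_p_def q_def g_def[abs_def])
    next
      have "(\<lambda>n. 2 * J n powr (1 / q)) \<longlonglongrightarrow> 2 * 0 powr (1 / q)"
        using q J0 by (intro tendsto_mult tendsto_const tendsto_powr' J) (auto intro!: always_eventually less_imp_le)
      then show "(\<lambda>n. 2 * J n powr (1 / q)) \<longlonglongrightarrow> 0" by simp
    qed simp
  qed
qed

theorem theorem4p2:
  fixes p :: ennreal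
    and b :: "real ^ 'd::finite \<Rightarrow> real ^ 'd"
    and \<delta> :: real
    and M0 :: "'b measure" and T0 :: "real \<Rightarrow> 'b \<Rightarrow> real"
    and M :: "real ^ 'd \<Rightarrow> 'a measure"
    and W :: "real ^ 'd \<Rightarrow> real \<Rightarrow> 'a \<Rightarrow> real ^ 'd"
    and T :: "real ^ 'd \<Rightarrow> real \<Rightarrow> 'a \<Rightarrow> real"
    and X :: "real ^ 'd \<Rightarrow> real \<Rightarrow> 'a \<Rightarrow> real ^ 'd"
  assumes p: "1 \<le> p"
    and b_cont: "continuous_on UNIV b" and b_bdd: "bounded (range b)"
    and T0_sub: "subordinator M0 T0"
    and W_wiener: "\<And>x. wiener_process (M x) (W x)"
    and T_sub: "\<And>x. subordinator (M x) (T x)"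
    and T_law: "\<And>x. same_fdd (M x) (T x) M0 T0"
    and WT_indep: "\<And>x. prob_space.indep_set (M x)
          (proc_sigma (M x) (W x)) (proc_sigma (M x) (T x))"
    and X_meas: "\<And>x t. X x t \<in> borel_measurable (M x)"
    and X_sol: "\<And>x. AE \<omega> in M x. \<forall>t\<ge>0.
          (\<lambda>s. b (X x s \<omega>)) integrable_on {0..t} \<and>
          X x t \<omega> = x + integral {0..t} (\<lambda>s. b (X x s \<omega>)) + W x (T x t \<omega>) \<omega>"
    and X_markov: "\<And>x s t f. 0 \<le> s \<Longrightarrow> 0 \<le> t \<Longrightarrow> f \<in> borel_measurable borel \<Longrightarrow>
          bounded (range f) \<Longrightarrow>
          AE \<omega> in M x. real_cond_exp (M x) (nat_filtration (M x) (X x) s) (\<lambda>\<omega>. f (X x (s + t) \<omega>)) \<omega>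
                         = trans_sg M X t f (X x s \<omega>)"
    and feller: "\<And>t f. 0 \<le> t \<Longrightarrow> continuous_on UNIV f \<Longrightarrow> bounded (range f) \<Longrightarrow>
          continuous_on UNIV (trans_sg M X t f)"
    and delta: "\<delta> > 0"
    and integ: "(\<integral>\<^sup>+ s. indicator {0<..\<delta>} s *
          (\<integral>\<^sup>+ \<omega>. ennreal (T0 s \<omega> powr (- 1/2 - d_over_p CARD('d) p / 2)) \<partial>M0) \<partial>lborel) < \<top>"
  shows "\<forall>t>0. \<forall>f. Lp_fun p f \<longrightarrow>
           (\<forall>x. integrable (M x) (\<lambda>\<omega>. f (X x t \<omega>))) \<and>
           continuous_on UNIV (trans_sg M X t f) \<and> bounded (range (trans_sg M X t f))"
proof -
  obtain B where B: "\<And>z. norm (b z) \<le> B" using b_bdd by (auto simp: bounded_iff)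
  have \<kappa>: "0 \<le> d_over_p CARD('d) p / 2" by (simp add: d_over_p_def)
  \<comment> \<open>\<kappa> is instantiated to half of \<open>d_over_p CARD('d) p\<close>, the
    exponent in \<open>integ\<close>; it is 0 for \<open>p = \<top>\<close>.\<close>
  interpret subordinated_sde b "d_over_p CARD('d) p / 2" \<delta> B M0 T0 M W T X
    by unfold_locales (fact \<kappa> B T0_sub W_wiener T_sub T_law WT_indep X_meas X_sol X_markov feller delta integ)+
  show ?thesis
  proof (intro allI impI)
    fix t :: real and f :: "real ^ 'd \<Rightarrow> real" assume "0 < t" and f: "Lp_fun p f"
    have fm: "f \<in> borel_measurable borel" using f by (simp add: Lp_fun_def)
    obtain N where N: "\<And>n. heat_bounded (d_over_p CARD('d) p / 2) (N n) (\<lambda>y. max 0 (\<bar>f y\<bar> - real n))"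
        "\<And>n. 0 \<le> N n" "N \<longlonglongrightarrow> 0"
      using Lp_fun_heat_bounded_tail[OF p f prob_space_gauss_vec[OF W_wiener]] by blast
    from heat_regular[OF fm \<open>0 < t\<close> N]
    show "(\<forall>x. integrable (M x) (\<lambda>\<omega>. f (X x t \<omega>))) \<and>
        continuous_on UNIV (trans_sg M X t f) \<and> bounded (range (trans_sg M X t f))" by blast
  qed
qed

end
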